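(* Let $A$ be a free Perm algebra, i.e. $A\cong\mathrm{Perm}\langle X\rangle$ for some set $X$, let $(B,\prec,\succ)$ be a pre-associative (dendriform) algebra, and let $N$ be a $B$-bimodule (representation of $B$). Then the cochain map $$\Psi: C^*_{\mathrm{dend}}(B,N)\to C^*_{\mathrm{Hoch}}(A\otimes B,A\otimes N)$$ given for $n\ge1$, $f\in C^n_{\mathrm{dend}}(B,N)$, $a_i\in A$, $b_i\in B$ by $$\Psi(f)(a_1\otimes b_1,\dots,a_n\otimes b_n)=\sum_{r=1}^{n} \bigl(a_r a_{r-1}\cdots a_1\, a_{r+1}a_{r+2}\cdots a_n\bigr)\otimes f(r,b_1,\dots,b_n)$$ is injective.
   Context: All algebras are over a field $\Bbbk$, not necessarily unital; $\otimes=\otimes_\Bbbk$. Perm algebra: an algebra with $(ab)c=a(bc)=a(cb)$ for all $a,b,c$. Free Perm algebra on a set $X=\{x_1,x_2,\dots\}$: let $F\langle X\rangle$ be the free non-unital associative algebra on $X$ and $I$ the two-sided ideal generated by all $x(yz)-x(zy)$, $x,y,z\in F\langle X\rangle$; then $\mathrm{Perm}\langle X\rangle:=F\langle X\rangle/I$. It is free in the sense that any map from $X$ to a Perm algebra extends uniquely to a homomorphism from $\mathrm{Perm}\langle X\rangle$. Pre-associative (dendriform) algebra: a vector space $B$ with bilinear operations $\prec,\succ$ such that for all $x,y,z\in B$: $(x\prec y)\prec z=x\prec(y\prec z+y\succ z)$, $\ (x\succ y)\prec z=x\succ(y\prec z)$, $\ x\succ(y\succ z)=(x\prec y+x\succ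 y)\succ z$. Write $x*y:=x\prec y+x\succ y$. Representation ($B$-bimodule) of $B$: a vector space $N$ with bilinear maps $\prec,\succ:B\otimes N\to N$ and $\prec,\succ:N\otimes B\to N$ such that the three identities above hold whenever exactly one of $x,y,z$ lies in $N$ and the other two lie in $B$. $A\otimes B$ is the associative algebra with product $(a_1\otimes b_1)(a_2\otimes b_2)=a_1a_2\otimes(b_1\prec b_2)+a_2a_1\otimes(b_1\succ b_2)$. $A\otimes N$ is the $A\otimes B$-bimodule with $(a\otimes n)\cdot(a'\otimes b)=aa'\otimes(n\prec b)+a'a\otimes(n\succ b)$ and $(a'\otimes b)\cdot(a\otimes n)=a'a\otimes(b\prec n)+aa'\otimes(b\succ n)$. Pre-associative cochain complex: for $n\ge1$, $C_n=\{1,\dots,n\}$ and $C^n_{\mathrm{dend}}(B,N)=\mathrm{Hom}_\Bbbk(\Bbbk[C_n]\otimes B^{\otimes n},N)$, i.e. an $n$-cochain $f$ is a family of $n$ multilinear maps $f(r,-,\dots,-):B^{\otimes n}\to N$, $r=1,\dots,n$. The differential $\delta_{\mathrm{dend}}:C^n_{\mathrm{dend}}(B,N)\to C^{n+1}_{\mathrm{dend}}(B,N)$ is: for $r=1$: $(\delta_{\mathrm{dend}}f)(1,b_1,\dots,b_{n+1})=\sum_{i=1}^n b_1\prec f(i,b_2,\dots,b_{n+1})-f(1,b_1\prec b_2,b_3,\dots,b_{n+1})+\sum_{i=2}^n(-1)^i f(1,b_1,\dots,b_i*b_{i+1},\dots,b_{n+1})+(-1)^{n+1}f(1,b_1,\dots,b_n)\prec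 b_{n+1}$; for $2\le r\le n$: $(\delta_{\mathrm{dend}}f)(r,b_1,\dots,b_{n+1})=b_1\succ f(r-1,b_2,\dots,b_{n+1})+\sum_{i=1}^{r-2}(-1)^i f(r-1,b_1,\dots,b_i*b_{i+1},\dots,b_{n+1})+(-1)^{r-1}f(r-1,b_1,\dots,b_{r-1}\succ b_r,\dots,b_{n+1})+(-1)^r f(r,b_1,\dots,b_r\prec b_{r+1},\dots,b_{n+1})+\sum_{i=r+1}^n(-1)^i f(r,b_1,\dots,b_i*b_{i+1},\dots,b_{n+1})+(-1)^{n+1}f(r,b_1,\dots,b_n)\prec b_{n+1}$; for $r=n+1$: $(\delta_{\mathrm{dend}}f)(n+1,b_1,\dots,b_{n+1})=b_1\succ f(n,b_2,\dots,b_{n+1})+\sum_{i=1}^{n-1}(-1)^i f(n,b_1,\dots,b_i*b_{i+1},\dots,b_{n+1})+(-1)^n f(n,b_1,\dots,b_{n-1},b_n\succ b_{n+1})+(-1)^{n+1}\sum_{i=1}^n f(i,b_1,\dots,b_n)\succ b_{n+1}$. Hochschild complex: $C^n_{\mathrm{Hoch}}(R,M)=\mathrm{Hom}_\Bbbk(R^{\otimes n},M)$ for an associative algebra $R$ and $R$-bimodule $M$, with the usual Hochschild differential.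
   Formalization: The formal theorem assumes that X has at least two elements; for X empty A = 0, and for |X| = 1 A is commutative, so Ψ only sees the sum of the f(r,–) and is not injective (e.g. n = 2, f(2,–) = −f(1,–) ≠ 0). *)

theory Defs
  imports "HOL.Vector_Spaces" "HOL-Library.Poly_Mapping"
begin

section \<open>Vector spaces, multilinear maps and quotients\<close>

text \<open>A vector space over the field \<open>'k\<close> is a type of class \<open>ab_group_add\<close> together with a
  scalar multiplication satisfying \<^const>\<open>vector_space\<close>.\<close>

definition bilinear_map ::
  "('k::field \<Rightarrow> 'u::ab_group_add \<Rightarrow> 'u) \<Rightarrow> ('k \<Rightarrow> 'v::ab_group_add \<Rightarrow> 'v) \<Rightarrow>
   ('k \<Rightarrow> 'w::ab_group_add \<Rightarrow> 'w) \<Rightarrow> ('u \<Rightarrow> 'v \<Rightarrow> 'w) \<Rightarrow> bool" where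
  "bilinear_map s1 s2 s3 m \<longleftrightarrow>
     (\<forall>u. Vector_Spaces.linear s2 s3 (\<lambda>v. m u v)) \<and>
     (\<forall>v. Vector_Spaces.linear s1 s3 (\<lambda>u. m u v))"

text \<open>\<open>n\<close>-linear maps are functions on lists, normalised to \<open>0\<close> on lists whose length is not \<open>n\<close>,
  so that equality of functions is equality of multilinear maps.\<close>

definition multilinear_maps ::
  "nat \<Rightarrow> ('k::field \<Rightarrow> 'u::ab_group_add \<Rightarrow> 'u) \<Rightarrow> ('k \<Rightarrow> 'w::ab_group_add \<Rightarrow> 'w) \<Rightarrow>
   ('u list \<Rightarrow> 'w) set" where
  "multilinear_maps n s1 s2 =
     {g. (\<forall>us. length us \<noteq> n \<longrightarrow> g us = 0) \<and>
         (\<forall>us i. length us = n \<longrightarrow> i < n \<longrightarrow> Vector_Spaces.linear s1 s2 (\<lambda>u. g (us[i := u])))}"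

definition free_scale :: "'k::field \<Rightarrow> ('i \<Rightarrow>\<^sub>0 'k) \<Rightarrow> ('i \<Rightarrow>\<^sub>0 'k)" where
  "free_scale c p = Poly_Mapping.map (\<lambda>d. c * d) p"

definition cong_mod :: "'v::ab_group_add set \<Rightarrow> 'v set \<Rightarrow> ('v \<times> 'v) set" where
  "cong_mod V W = {(p, q). p \<in> V \<and> q \<in> V \<and> p - q \<in> W}"

definition coset_of :: "'v::ab_group_add set \<Rightarrow> 'v set \<Rightarrow> 'v \<Rightarrow> 'v set" where
  "coset_of V W p = cong_mod V W `` {p}"

text \<open>\<open>\<phi>\<close> is a linear isomorphism from the quotient space \<open>V / W\<close> onto the whole type; the vector
  space operations of the quotient are those induced on representatives.\<close>

definition quotient_iso ::
  "('k::field \<Rightarrow> 'v::ab_group_add \<Rightarrow> 'v) \<Rightarrow> 'v set \<Rightarrow> 'v set \<Rightarrow>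
   ('k \<Rightarrow> 'w::ab_group_add \<Rightarrow> 'w) \<Rightarrow> ('v set \<Rightarrow> 'w) \<Rightarrow> bool" where
  "quotient_iso s V W s' \<phi> \<longleftrightarrow>
     bij_betw \<phi> (V // cong_mod V W) UNIV \<and>
     (\<forall>p\<in>V. \<forall>q\<in>V. \<phi> (coset_of V W (p + q)) = \<phi> (coset_of V W p) + \<phi> (coset_of V W q)) \<and>
     (\<forall>c. \<forall>p\<in>V. \<phi> (coset_of V W (s c p)) = s' c (\<phi> (coset_of V W p)))"


section \<open>Tensor products\<close>

definition tensor_relations ::
  "('k::field \<Rightarrow> 'u::ab_group_add \<Rightarrow> 'u) \<Rightarrow> ('k \<Rightarrow> 'v::ab_group_add \<Rightarrow> 'v) \<Rightarrow>
   (('u \<times> 'v) \<Rightarrow>\<^sub>0 'k) set" where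
  "tensor_relations s1 s2 = module.span free_scale
     ({Poly_Mapping.single (u + u', v) 1 - Poly_Mapping.single (u, v) 1
         - Poly_Mapping.single (u', v) 1 | u u' v. True} \<union>
      {Poly_Mapping.single (u, v + v') 1 - Poly_Mapping.single (u, v) 1
         - Poly_Mapping.single (u, v') 1 | u v v'. True} \<union>
      {Poly_Mapping.single (s1 c u, v) 1 - free_scale c (Poly_Mapping.single (u, v) 1)
         | c u v. True} \<union>
      {Poly_Mapping.single (u, s2 c v) 1 - free_scale c (Poly_Mapping.single (u, v) 1)
         | c u v. True})"

text \<open>The tensor product is the free vector space on pairs modulo the bilinearity relations. Since
  that quotient depends on the scalar multiplications, it cannot be a type constructor; instead, a
  vector space \<open>'t\<close> with a map \<open>t\<close> (playing the role of \<open>\<otimes>\<close>) is called a tensor product if it is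
  isomorphic to that quotient, with \<open>t u v\<close> corresponding to the class of \<open>(u, v)\<close>.\<close>

definition is_tensor_product ::
  "('k::field \<Rightarrow> 'u::ab_group_add \<Rightarrow> 'u) \<Rightarrow> ('k \<Rightarrow> 'v::ab_group_add \<Rightarrow> 'v) \<Rightarrow>
   ('k \<Rightarrow> 't::ab_group_add \<Rightarrow> 't) \<Rightarrow> ('u \<Rightarrow> 'v \<Rightarrow> 't) \<Rightarrow> bool" where
  "is_tensor_product s1 s2 sT t \<longleftrightarrow>
     vector_space s1 \<and> vector_space s2 \<and> vector_space sT \<and>
     (\<exists>\<phi>. quotient_iso free_scale UNIV (tensor_relations s1 s2) sT \<phi> \<and>
          (\<forall>u v. \<phi> (coset_of UNIV (tensor_relations s1 s2) (Poly_Mapping.single (u, v) 1)) = t u v))"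


section \<open>Algebras and the free Perm algebra\<close>

record ('k, 'a) alg =
  scl :: "'k \<Rightarrow> 'a \<Rightarrow> 'a"
  mul :: "'a \<Rightarrow> 'a \<Rightarrow> 'a"

text \<open>With concatenation of words as monoid operation, the product of \<^typ>\<open>'x list \<Rightarrow>\<^sub>0 'k\<close> is that
  of the free unital associative algebra; the free non-unital one is the subspace without constant
  term.\<close>

instantiation list :: (type) monoid_add
begin

definition zero_list :: "'a list" where "zero_list = []"

definition plus_list :: "'a list \<Rightarrow> 'a list \<Rightarrow> 'a list" where "plus_list u v = u @ v"

instance by standard (simp_all add: zero_list_def plus_list_def)

end

definition free_assoc :: "'x set \<Rightarrow> ('x list \<Rightarrow>\<^sub>0 'k::field) set" where
  "free_assoc X = {p. \<forall>w \<in> Poly_Mapping.keys p. w \<noteq> [] \<and> set w \<subseteq> X}"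

inductive_set perm_ideal :: "'x set \<Rightarrow> ('x list \<Rightarrow>\<^sub>0 'k::field) set" for X :: "'x set" where
  gen: "x \<in> free_assoc X \<Longrightarrow> y \<in> free_assoc X \<Longrightarrow> z \<in> free_assoc X \<Longrightarrow>
          x * (y * z) - x * (z * y) \<in> perm_ideal X"
| zero: "0 \<in> perm_ideal X"
| add: "p \<in> perm_ideal X \<Longrightarrow> q \<in> perm_ideal X \<Longrightarrow> p + q \<in> perm_ideal X"
| scale: "p \<in> perm_ideal X \<Longrightarrow> free_scale c p \<in> perm_ideal X"
| left: "u \<in> free_assoc X \<Longrightarrow> p \<in> perm_ideal X \<Longrightarrow> u * p \<in> perm_ideal X"
| right: "p \<in> perm_ideal X \<Longrightarrow> u \<in> free_assoc X \<Longrightarrow> p * u \<in> perm_ideal X"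

text \<open>\<open>A\<close> is isomorphic, as an algebra, to the quotient of \<^term>\<open>free_assoc X\<close> by
  \<^term>\<open>perm_ideal X\<close>.\<close>

definition free_perm_algebra :: "'x set \<Rightarrow> ('k::field, 'a::ab_group_add) alg \<Rightarrow> bool" where
  "free_perm_algebra X A \<longleftrightarrow> vector_space (scl A) \<and>
     (\<exists>\<phi>. quotient_iso free_scale (free_assoc X) (perm_ideal X) (scl A) \<phi> \<and>
          (\<forall>p\<in>free_assoc X. \<forall>q\<in>free_assoc X.
             \<phi> (coset_of (free_assoc X) (perm_ideal X) (p * q)) =
             mul A (\<phi> (coset_of (free_assoc X) (perm_ideal X) p))
                   (\<phi> (coset_of (free_assoc X) (perm_ideal X) q))))"


section \<open>Dendriform algebras and their representations\<close>

record ('k, 'b) dend =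
  dscl :: "'k \<Rightarrow> 'b \<Rightarrow> 'b"
  dprec :: "'b \<Rightarrow> 'b \<Rightarrow> 'b"
  dsucc :: "'b \<Rightarrow> 'b \<Rightarrow> 'b"

definition dstar :: "('k, 'b::ab_group_add) dend \<Rightarrow> 'b \<Rightarrow> 'b \<Rightarrow> 'b" where
  "dstar B x y = dprec B x y + dsucc B x y"

definition dendriform :: "('k::field, 'b::ab_group_add) dend \<Rightarrow> bool" where
  "dendriform B \<longleftrightarrow> vector_space (dscl B) \<and>
     bilinear_map (dscl B) (dscl B) (dscl B) (dprec B) \<and>
     bilinear_map (dscl B) (dscl B) (dscl B) (dsucc B) \<and>
     (\<forall>x y z.
        dprec B (dprec B x y) z = dprec B x (dstar B y z) \<and>
        dprec B (dsucc B x y) z = dsucc B x (dprec B y z) \<and>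
        dsucc B x (dsucc B y z) = dsucc B (dstar B x y) z)"

text \<open>The prefixes \<open>l\<close> and \<open>r\<close> indicate the side from which \<open>'b\<close> acts.\<close>

record ('k, 'b, 'n) dend_rep =
  nscl :: "'k \<Rightarrow> 'n \<Rightarrow> 'n"
  lprec :: "'b \<Rightarrow> 'n \<Rightarrow> 'n"
  lsucc :: "'b \<Rightarrow> 'n \<Rightarrow> 'n"
  rprec :: "'n \<Rightarrow> 'b \<Rightarrow> 'n"
  rsucc :: "'n \<Rightarrow> 'b \<Rightarrow> 'n"

definition dend_representation ::
  "('k::field, 'b::ab_group_add) dend \<Rightarrow> ('k, 'b, 'n::ab_group_add) dend_rep \<Rightarrow> bool" where
  "dend_representation B N \<longleftrightarrow> vector_space (nscl N) \<and>
     bilinear_map (dscl B) (nscl N) (nscl N) (lprec N) \<and>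
     bilinear_map (dscl B) (nscl N) (nscl N) (lsucc N) \<and>
     bilinear_map (nscl N) (dscl B) (nscl N) (rprec N) \<and>
     bilinear_map (nscl N) (dscl B) (nscl N) (rsucc N) \<and>
     (\<forall>x y z.
        rprec N (rprec N x y) z = rprec N x (dstar B y z) \<and>
        rprec N (rsucc N x y) z = rsucc N x (dprec B y z) \<and>
        rsucc N x (dsucc B y z) = rsucc N (rprec N x y + rsucc N x y) z) \<and>
     (\<forall>x y z.
        rprec N (lprec N x y) z = lprec N x (rprec N y z + rsucc N y z) \<and>
        rprec N (lsucc N x y) z = lsucc N x (rprec N y z) \<and>
        lsucc N x (rsucc N y z) = rsucc N (lprec N x y + lsucc N x y) z) \<and>
     (\<forall>x y z.
        lprec N (dprec B x y) z = lprec N x (lprec N y z + lsucc N y z) \<and>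
        lprec N (dsucc B x y) z = lsucc N x (lprec N y z) \<and>
        lsucc N x (lsucc N y z) = lsucc N (dstar B x y) z)"


section \<open>The dendriform cochain complex\<close>

text \<open>\<open>[b\<^sub>1, \<dots>, m b\<^sub>i b\<^bsub>i+1\<^esub>, \<dots>]\<close>, with the index \<open>i\<close> starting at 1.\<close>

definition merge :: "('u \<Rightarrow> 'u \<Rightarrow> 'u) \<Rightarrow> nat \<Rightarrow> 'u list \<Rightarrow> 'u list" where
  "merge m i us = take (i - 1) us @ [m (us ! (i - 1)) (us ! i)] @ drop (i + 1) us"

text \<open>A cochain is a family of multilinear maps \<open>f r\<close>, \<open>r = 1, \<dots>, n\<close>, extended by \<open>0\<close> to other
  values of \<open>r\<close>.\<close>

definition dend_cochains ::
  "('k::field, 'b::ab_group_add) dend \<Rightarrow> ('k, 'b, 'n::ab_group_add) dend_rep \<Rightarrow> nat \<Rightarrow>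
   (nat \<Rightarrow> 'b list \<Rightarrow> 'n) set" where
  "dend_cochains B N n =
     {f. (\<forall>r\<in>{1..n}. f r \<in> multilinear_maps n (dscl B) (nscl N)) \<and>
         (\<forall>r bs. r \<notin> {1..n} \<longrightarrow> f r bs = 0)}"

definition dend_diff ::
  "('k::field, 'b::ab_group_add) dend \<Rightarrow> ('k, 'b, 'n::ab_group_add) dend_rep \<Rightarrow> nat \<Rightarrow>
   (nat \<Rightarrow> 'b list \<Rightarrow> 'n) \<Rightarrow> (nat \<Rightarrow> 'b list \<Rightarrow> 'n)" where
  "dend_diff B N n f r bs =
     (if length bs \<noteq> n + 1 \<or> r \<notin> {1..n+1} then 0
      else if r = 1 then
        (\<Sum>i=1..n. lprec N (hd bs) (f i (tl bs)))
        - f 1 (merge (dprec B) 1 bs)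
        + (\<Sum>i=2..n. nscl N ((-1)^i) (f 1 (merge (dstar B) i bs)))
        + nscl N ((-1)^(n+1)) (rprec N (f 1 (butlast bs)) (last bs))
      else if r \<le> n then
        lsucc N (hd bs) (f (r - 1) (tl bs))
        + (\<Sum>i=1..r-2. nscl N ((-1)^i) (f (r - 1) (merge (dstar B) i bs)))
        + nscl N ((-1)^(r-1)) (f (r - 1) (merge (dsucc B) (r - 1) bs))
        + nscl N ((-1)^r) (f r (merge (dprec B) r bs))
        + (\<Sum>i=r+1..n. nscl N ((-1)^i) (f r (merge (dstar B) i bs)))
        + nscl N ((-1)^(n+1)) (rprec N (f r (butlast bs)) (last bs))
      else
        lsucc N (hd bs) (f n (tl bs))
        + (\<Sum>i=1..n-1. nscl N ((-1)^i) (f n (merge (dstar B) i bs)))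
        + nscl N ((-1)^n) (f n (merge (dsucc B) n bs))
        + nscl N ((-1)^(n+1)) (\<Sum>i=1..n. rsucc N (f i (butlast bs)) (last bs)))"


section \<open>The Hochschild cochain complex\<close>

record ('k, 'r, 'm) bimod =
  mscl :: "'k \<Rightarrow> 'm \<Rightarrow> 'm"
  lact :: "'r \<Rightarrow> 'm \<Rightarrow> 'm"
  ract :: "'m \<Rightarrow> 'r \<Rightarrow> 'm"

definition hoch_cochains ::
  "('k::field, 'r::ab_group_add) alg \<Rightarrow> ('k, 'r, 'm::ab_group_add) bimod \<Rightarrow> nat \<Rightarrow>
   ('r list \<Rightarrow> 'm) set" where
  "hoch_cochains R M n = multilinear_maps n (scl R) (mscl M)"

definition hoch_diff ::
  "('k::field, 'r::ab_group_add) alg \<Rightarrow> ('k, 'r, 'm::ab_group_add) bimod \<Rightarrow> nat \<Rightarrow>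
   ('r list \<Rightarrow> 'm) \<Rightarrow> ('r list \<Rightarrow> 'm)" where
  "hoch_diff R M n g rs =
     (if length rs \<noteq> n + 1 then 0
      else lact M (hd rs) (g (tl rs))
        + (\<Sum>i=1..n. mscl M ((-1)^i) (g (merge (mul R) i rs)))
        + mscl M ((-1)^(n+1)) (ract M (g (butlast rs)) (last rs)))"


section \<open>The algebra \<open>A \<otimes> B\<close>, the bimodule \<open>A \<otimes> N\<close> and the map \<open>\<Psi>\<close>\<close>

definition tensor_alg ::
  "('k::field, 'a::ab_group_add) alg \<Rightarrow> ('k, 'b::ab_group_add) dend \<Rightarrow>
   ('k \<Rightarrow> 'r::ab_group_add \<Rightarrow> 'r) \<Rightarrow> ('a \<Rightarrow> 'b \<Rightarrow> 'r) \<Rightarrow> ('k, 'r) alg" where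
  "tensor_alg A B sR t =
     \<lparr> scl = sR,
       mul = (THE m. bilinear_map sR sR sR m \<and>
         (\<forall>a1 b1 a2 b2. m (t a1 b1) (t a2 b2) =
            t (mul A a1 a2) (dprec B b1 b2) + t (mul A a2 a1) (dsucc B b1 b2))) \<rparr>"

definition tensor_bimod ::
  "('k::field, 'a::ab_group_add) alg \<Rightarrow> ('k, 'b::ab_group_add) dend \<Rightarrow>
   ('k, 'b, 'n::ab_group_add) dend_rep \<Rightarrow>
   ('k \<Rightarrow> 'r::ab_group_add \<Rightarrow> 'r) \<Rightarrow> ('a \<Rightarrow> 'b \<Rightarrow> 'r) \<Rightarrow>
   ('k \<Rightarrow> 'm::ab_group_add \<Rightarrow> 'm) \<Rightarrow> ('a \<Rightarrow> 'n \<Rightarrow> 'm) \<Rightarrow> ('k, 'r, 'm) bimod" where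
  "tensor_bimod A B N sR tB sM tN =
     \<lparr> mscl = sM,
       lact = (THE l. bilinear_map sR sM sM l \<and>
         (\<forall>a' b a n. l (tB a' b) (tN a n) =
            tN (mul A a' a) (lprec N b n) + tN (mul A a a') (lsucc N b n))),
       ract = (THE l. bilinear_map sM sR sM l \<and>
         (\<forall>a n a' b. l (tN a n) (tB a' b) =
            tN (mul A a a') (rprec N n b) + tN (mul A a' a) (rsucc N n b))) \<rparr>"

text \<open>The product \<open>a\<^sub>r a\<^bsub>r-1\<^esub> \<dots> a\<^sub>1 a\<^bsub>r+1\<^esub> \<dots> a\<^sub>n\<close>, for \<open>r\<close> between 1 and \<open>n\<close>.\<close>

definition perm_product :: "('k, 'a) alg \<Rightarrow> nat \<Rightarrow> 'a list \<Rightarrow> 'a" where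
  "perm_product A r as = foldl (mul A) (as ! (r - 1)) (rev (take (r - 1) as) @ drop r as)"

definition Psi_formula ::
  "('k::field, 'a::ab_group_add) alg \<Rightarrow> ('a \<Rightarrow> 'b \<Rightarrow> 'r) \<Rightarrow> ('a \<Rightarrow> 'n \<Rightarrow> 'm) \<Rightarrow>
   nat \<Rightarrow> (nat \<Rightarrow> 'b list \<Rightarrow> 'n) \<Rightarrow> ('r list \<Rightarrow> 'm::ab_group_add) \<Rightarrow> bool" where
  "Psi_formula A tB tN n f g \<longleftrightarrow>
     (\<forall>as bs. length as = n \<longrightarrow> length bs = n \<longrightarrow>
        g (map2 tB as bs) = (\<Sum>r=1..n. tN (perm_product A r as) (f r bs)))"

definition Psi ::
  "('k::field, 'a::ab_group_add) alg \<Rightarrow> ('k \<Rightarrow> 'r::ab_group_add \<Rightarrow> 'r) \<Rightarrow> ('a \<Rightarrow> 'b \<Rightarrow> 'r) \<Rightarrow>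
   ('k \<Rightarrow> 'm::ab_group_add \<Rightarrow> 'm) \<Rightarrow> ('a \<Rightarrow> 'n \<Rightarrow> 'm) \<Rightarrow>
   nat \<Rightarrow> (nat \<Rightarrow> 'b list \<Rightarrow> 'n) \<Rightarrow> ('r list \<Rightarrow> 'm)" where
  "Psi A sR tB sM tN n f =
     (THE g. g \<in> multilinear_maps n sR sM \<and> Psi_formula A tB tN n f g)"

end

theory Submission
  imports Defs "HOL-Library.Multiset"
begin

text \<open>Injectivity: on \<open>A\<close> there is a linear functional \<open>\<mu>\<close>, the sum of the coefficients of all words
  beginning with a fixed generator \<open>x\<close>, and the augmentation \<open>\<epsilon>\<close>; both vanish on the Perm ideal and
  \<open>\<mu> (a b) = \<mu> a \<epsilon> b\<close>. Put \<open>x\<close> into the \<open>r\<close>-th slot and another generator \<open>y\<close> into all others: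
  the \<open>s\<close>-th summand of \<open>\<Psi> f\<close> has an element beginning with the \<open>s\<close>-th entry on the left of
  the tensor sign, so \<open>\<mu> \<otimes> id\<close> kills all summands but the \<open>r\<close>-th and returns \<open>f r\<close>.

  Compatibility with the differentials: in a Perm algebra a product depends only on its first factor
  and on the multiset of the others. Hence multiplying two neighbours (in either order) in
  \<open>a\<^sub>s \<dots> a\<^sub>1 a\<^bsub>s+1\<^esub> \<dots> a\<^sub>n\<close> gives one of the products for the unmerged list, and the Hochschild
  differential can be sorted by the first factor.\<close>

section \<open>Linear maps and the universal property of the tensor product\<close>

definition free_lift :: "('k::field \<Rightarrow> 'w::ab_group_add \<Rightarrow> 'w) \<Rightarrow> ('i \<Rightarrow> 'w) \<Rightarrow> ('i \<Rightarrow>\<^sub>0 'k) \<Rightarrow> 'w" where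
  "free_lift s h p = (\<Sum>i\<in>Poly_Mapping.keys p. s (Poly_Mapping.lookup p i) (h i))"

lemma lookup_free_scale [simp]:
  "Poly_Mapping.lookup (free_scale c p) i = c * Poly_Mapping.lookup p i"
  by (simp add: free_scale_def Poly_Mapping.map.rep_eq when_def)

lemma vector_space_free_scale: "vector_space free_scale"
  by unfold_locales (auto intro!: poly_mapping_eqI simp: lookup_add algebra_simps)

lemma vector_space_mult: "vector_space ((*) :: 'k::field \<Rightarrow> 'k \<Rightarrow> 'k)"
  by unfold_locales (auto simp: algebra_simps)

text \<open>Zero coefficients contribute nothing, so elements with different supports can be summed
  over one common finite index set; additivity and homogeneity of \<open>free_lift\<close> follow
  from this.\<close>

lemma free_lift_superset:
  assumes "vector_space s" "finite S" "Poly_Mapping.keys p \<subseteq> S"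
  shows "free_lift s h p = (\<Sum>i\<in>S. s (Poly_Mapping.lookup p i) (h i))"
proof -
  interpret vector_space s by fact
  show ?thesis
    unfolding free_lift_def using assms(2,3)
    by (intro sum.mono_neutral_left) (auto simp: in_keys_iff)
qed

lemma linear_free_lift:
  assumes "vector_space s"
  shows "Vector_Spaces.linear free_scale s (free_lift s h)"
proof -
  interpret vector_space s by fact
  have add: "free_lift s h (p + q) = free_lift s h p + free_lift s h q" for p q
    using free_lift_superset[OF assms, of "Poly_Mapping.keys p \<union> Poly_Mapping.keys q" _ h]
      Poly_Mapping.keys_add[of p q]
    by (simp add: lookup_add scale_left_distrib sum.distrib)
  have "Poly_Mapping.keys (free_scale c p) \<subseteq> Poly_Mapping.keys p" for c :: 'a and p :: "'c \<Rightarrow>\<^sub>0 'a"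
    by (auto simp: in_keys_iff)
  then have "free_lift s h (free_scale c p) = s c (free_lift s h p)" for c p
    using free_lift_superset[OF assms, of "Poly_Mapping.keys p" _ h]
    by (simp add: scale_sum_right)
  with add show ?thesis
    by (simp add: linear_iff assms vector_space_free_scale)
qed

lemma free_lift_single:
  assumes "vector_space s"
  shows "free_lift s h (Poly_Mapping.single i c) = s c (h i)"
proof -
  interpret vector_space s by fact
  show ?thesis
    using free_lift_superset[OF assms, of "{i}" "Poly_Mapping.single i c" h] by simp
qed

lemma poly_mapping_eq_sum_single:
  "p = (\<Sum>i\<in>Poly_Mapping.keys p. Poly_Mapping.single i (Poly_Mapping.lookup p i))"
  by (rule poly_mapping_eqI) (auto simp: lookup_sum lookup_single when_def in_keys_iff)

lemma linear_simps:
  assumes "Vector_Spaces.linear s1 s2 f"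
  shows "f (x + y) = f x + f y" "f (s1 c x) = s2 c (f x)" "f 0 = 0" "f (x - y) = f x - f y"
proof -
  interpret Vector_Spaces.linear s1 s2 f by fact
  show "f (x + y) = f x + f y" "f (s1 c x) = s2 c (f x)" "f 0 = 0" "f (x - y) = f x - f y"
    by (rule add scale zero diff)+
qed

lemma linear_sum_fun:
  assumes "Vector_Spaces.linear s1 s2 f"
  shows "f (sum g S) = (\<Sum>i\<in>S. f (g i))"
proof -
  interpret Vector_Spaces.linear s1 s2 f by fact
  show ?thesis by (rule sum)
qed

lemma linear_comp:
  assumes "Vector_Spaces.linear s1 s2 f" "Vector_Spaces.linear s2 s3 g"
  shows "Vector_Spaces.linear s1 s3 (\<lambda>x. g (f x))"
  using assms by (simp add: linear_iff)

lemma linear_eq_on_free: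
  assumes "Vector_Spaces.linear free_scale s f" "Vector_Spaces.linear free_scale s g"
    and "\<And>i. i \<in> Poly_Mapping.keys p \<Longrightarrow> f (Poly_Mapping.single i 1) = g (Poly_Mapping.single i 1)"
  shows "f p = g p"
proof -
  have sc: "Poly_Mapping.single i c = free_scale c (Poly_Mapping.single i 1)" for i and c :: 'a
    by (rule poly_mapping_eqI) (simp add: lookup_single when_def)
  have "f (Poly_Mapping.single i c) = g (Poly_Mapping.single i c)" if "i \<in> Poly_Mapping.keys p" for i c
    using assms that unfolding sc[of i c] linear_iff by simp
  then show ?thesis
    by (subst (1 2) poly_mapping_eq_sum_single)
      (simp add: linear_sum_fun[OF assms(1)] linear_sum_fun[OF assms(2)])
qed

section \<open>Cosets and quotient spaces\<close>

lemma coset_of_eqI: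
  assumes "p \<in> V" "q \<in> V" "p - q \<in> W"
    and "\<And>u v. u \<in> W \<Longrightarrow> v \<in> W \<Longrightarrow> u + v \<in> W" and "\<And>u. u \<in> W \<Longrightarrow> - u \<in> W"
  shows "coset_of V W p = coset_of V W q"
proof -
  have "p - r \<in> W \<longleftrightarrow> q - r \<in> W" for r
    using assms(3) assms(4)[of "q - p" "p - r"] assms(4)[of "p - q" "q - r"] assms(5)[of "p - q"]
    by auto
  then show ?thesis
    using assms(1,2) by (auto simp: coset_of_def cong_mod_def)
qed

lemma quotient_iso_surj:
  assumes "quotient_iso s V W s' \<phi>"
  obtains p where "p \<in> V" "\<phi> (coset_of V W p) = w"
proof -
  have "w \<in> \<phi> ` (V // cong_mod V W)"
    using assms by (simp add: quotient_iso_def bij_betw_def)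
  then show thesis
    using that by (auto simp: quotient_def coset_of_def)
qed

text \<open>Injectivity turns equal values into equal cosets, and \<open>0 \<in> W\<close> puts
  \<open>q\<close> into its own coset, hence into that of \<open>p\<close>.\<close>

lemma quotient_iso_eqD:
  assumes "quotient_iso s V W s' \<phi>" "p \<in> V" "q \<in> V" "0 \<in> W"
    and "\<phi> (coset_of V W p) = \<phi> (coset_of V W q)"
  shows "p - q \<in> W"
proof -
  have "inj_on \<phi> (V // cong_mod V W)"
    using assms(1) by (simp add: quotient_iso_def bij_betw_def)
  moreover have "coset_of V W r \<in> V // cong_mod V W" if "r \<in> V" for r
    using that by (auto simp: quotient_def coset_of_def)
  ultimately have "coset_of V W p = coset_of V W q"
    using assms by (meson inj_onD)
  moreover have "q \<in> coset_of V W q"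
    using assms by (simp add: coset_of_def cong_mod_def)
  ultimately show ?thesis
    by (auto simp: coset_of_def cong_mod_def)
qed

text \<open>Only closure of \<open>W\<close> under sums and negatives is asked for, so that the span
  of the tensor relations and the Perm ideal are treated alike.\<close>

lemma quotient_iso_cong:
  assumes "p \<in> V" "q \<in> V" "p - q \<in> W"
    and "\<And>u v. u \<in> W \<Longrightarrow> v \<in> W \<Longrightarrow> u + v \<in> W" and "\<And>u. u \<in> W \<Longrightarrow> - u \<in> W"
  shows "\<phi> (coset_of V W p) = \<phi> (coset_of V W q)"
  using coset_of_eqI[of p V q W] assms by metis

lemma bilinear_mapI:
  assumes "vector_space s1" "vector_space s2" "vector_space s3"
    and "\<And>u u' v. m (u + u') v = m u v + m u' v" "\<And>u v v'. m u (v + v') = m u v + m u v'"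
    and "\<And>c u v. m (s1 c u) v = s3 c (m u v)" "\<And>c u v. m u (s2 c v) = s3 c (m u v)"
  shows "bilinear_map s1 s2 s3 m"
  using assms by (simp add: bilinear_map_def linear_iff)

section \<open>The tensor product as a quotient of the free space on pairs\<close>

locale tensor_product =
  fixes s1 :: "'k::field \<Rightarrow> 'u::ab_group_add \<Rightarrow> 'u" and s2 :: "'k \<Rightarrow> 'v::ab_group_add \<Rightarrow> 'v"
    and sT :: "'k \<Rightarrow> 't::ab_group_add \<Rightarrow> 't" and t :: "'u \<Rightarrow> 'v \<Rightarrow> 't"
  assumes tp: "is_tensor_product s1 s2 sT t"
begin

abbreviation "W \<equiv> tensor_relations s1 s2"

lemma tensor_product_vector_spaces: "vector_space s1" "vector_space s2" "vector_space sT"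
  using tp by (simp_all add: is_tensor_product_def)

text \<open>The isomorphism with the quotient is only known to exist; this fixes one quotient map
  from the free space, with kernel \<open>W\<close>, for the whole locale.\<close>

definition proj :: "(('u \<times> 'v) \<Rightarrow>\<^sub>0 'k) \<Rightarrow> 't" where
  "proj = (SOME \<pi>. Vector_Spaces.linear free_scale sT \<pi> \<and> surj \<pi> \<and>
     (\<forall>p q. \<pi> p = \<pi> q \<longleftrightarrow> p - q \<in> W) \<and> (\<forall>u v. \<pi> (Poly_Mapping.single (u, v) 1) = t u v))"

lemma proj:
  "Vector_Spaces.linear free_scale sT proj" "surj proj" "proj p = proj q \<longleftrightarrow> p - q \<in> W"
  "proj (Poly_Mapping.single (u, v) 1) = t u v"
proof -
  interpret vector_space "free_scale :: 'k \<Rightarrow> (('u \<times> 'v) \<Rightarrow>\<^sub>0 'k) \<Rightarrow> _"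
    by (rule vector_space_free_scale)
  obtain \<phi> where iso: "quotient_iso free_scale UNIV W sT \<phi>"
    and t: "\<And>u v. \<phi> (coset_of UNIV W (Poly_Mapping.single (u, v) 1)) = t u v"
    using tp by (auto simp: is_tensor_product_def)
  let ?\<pi> = "\<lambda>p. \<phi> (coset_of UNIV W p)"
  have "Vector_Spaces.linear free_scale sT ?\<pi>"
    using iso by (simp add: linear_iff tensor_product_vector_spaces vector_space_free_scale quotient_iso_def)
  moreover have "surj ?\<pi>"
    unfolding surj_def by (metis quotient_iso_surj[OF iso])
  moreover have "?\<pi> p = ?\<pi> q \<longleftrightarrow> p - q \<in> W" for p q
    using quotient_iso_eqD[OF iso] quotient_iso_cong[of p UNIV q W \<phi>]
    by (auto simp: tensor_relations_def span_zero span_add span_neg)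
  ultimately have "\<exists>\<pi>. Vector_Spaces.linear free_scale sT \<pi> \<and> surj \<pi> \<and>
     (\<forall>p q. \<pi> p = \<pi> q \<longleftrightarrow> p - q \<in> W) \<and> (\<forall>u v. \<pi> (Poly_Mapping.single (u, v) 1) = t u v)"
    using t by (intro exI[of _ ?\<pi>]) auto
  from someI_ex[OF this, folded proj_def]
  show "Vector_Spaces.linear free_scale sT proj" "surj proj" "proj p = proj q \<longleftrightarrow> p - q \<in> W"
    "proj (Poly_Mapping.single (u, v) 1) = t u v"
    by blast+
qed

text \<open>Each law is one of the four families of generators of \<open>W\<close>, read through
  \<open>proj\<close>. The additive generators are iterated differences, which is the shape
  \<open>diff_diff_eq\<close> restores.\<close>

lemma bilinear_tensor: "bilinear_map s1 s2 sT t"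
proof (rule bilinear_mapI)
  interpret vector_space "free_scale :: 'k \<Rightarrow> (('u \<times> 'v) \<Rightarrow>\<^sub>0 'k) \<Rightarrow> _"
    by (rule vector_space_free_scale)
  let ?e = "\<lambda>u v. Poly_Mapping.single (u, v) (1::'k)"
  have lin: "proj (p + q) = proj p + proj q" "proj (free_scale c p) = sT c (proj p)" for p q c
    using proj(1) by (simp_all add: linear_iff)
  show "t (u + u') v = t u v + t u' v" for u u' v
  proof -
    have "?e (u + u') v - (?e u v + ?e u' v) \<in> W"
      unfolding tensor_relations_def diff_diff_eq[symmetric] by (rule span_base, intro UnI1) blast
    then show ?thesis
      using proj(3)[of "?e (u + u') v" "?e u v + ?e u' v"] by (simp add: proj(4) lin)
  qed
  show "t u (v + v') = t u v + t u v'" for u v v'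
  proof -
    have "?e u (v + v') - (?e u v + ?e u v') \<in> W"
      unfolding tensor_relations_def diff_diff_eq[symmetric] by (rule span_base, rule UnI1, rule UnI1, rule UnI2) blast
    then show ?thesis
      using proj(3)[of "?e u (v + v')" "?e u v + ?e u v'"] by (simp add: proj(4) lin)
  qed
  show "t (s1 c u) v = sT c (t u v)" for c u v
  proof -
    have "?e (s1 c u) v - free_scale c (?e u v) \<in> W"
      unfolding tensor_relations_def by (rule span_base, rule UnI1, rule UnI2) blast
    then show ?thesis
      using proj(3)[of "?e (s1 c u) v" "free_scale c (?e u v)"] by (simp add: proj(4) lin)
  qed
  show "t u (s2 c v) = sT c (t u v)" for c u v
  proof -
    have "?e u (s2 c v) - free_scale c (?e u v) \<in> W"
      unfolding tensor_relations_def by (rule span_base, rule UnI2) blast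
    then show ?thesis
      using proj(3)[of "?e u (s2 c v)" "free_scale c (?e u v)"] by (simp add: proj(4) lin)
  qed
qed (use tensor_product_vector_spaces in auto)

text \<open>Pure tensors are the images of the free basis under the surjection \<open>proj\<close>,
  so they span.\<close>

lemma linear_eq_on_tensors:
  assumes "Vector_Spaces.linear sT sW f" "Vector_Spaces.linear sT sW g" "\<And>u v. f (t u v) = g (t u v)"
  shows "f = g"
proof
  fix w
  obtain p where w: "w = proj p"
    using proj(2) by (meson surjD)
  have "f (proj p) = g (proj p)"
  proof (rule linear_eq_on_free)
    show "Vector_Spaces.linear free_scale sW (\<lambda>p. f (proj p))"
      "Vector_Spaces.linear free_scale sW (\<lambda>p. g (proj p))"
      by (rule linear_comp[OF proj(1)] assms)+
    show "f (proj (Poly_Mapping.single i 1)) = g (proj (Poly_Mapping.single i 1))" for i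
      by (cases i) (simp only: proj(4) assms(3))
  qed
  then show "f w = g w"
    by (simp only: w)
qed

text \<open>The linear extension of \<beta> to the free space kills the relations by bilinearity and
  therefore factors through \<open>proj\<close>.\<close>

lemma tensor_lift_exists:
  assumes "bilinear_map s1 s2 sW \<beta>"
  shows "\<exists>L. Vector_Spaces.linear sT sW L \<and> (\<forall>u v. L (t u v) = \<beta> u v)"
proof -
  have sW: "vector_space sW"
    using assms by (simp add: bilinear_map_def linear_iff)
  interpret vector_space "free_scale :: 'k \<Rightarrow> (('u \<times> 'v) \<Rightarrow>\<^sub>0 'k) \<Rightarrow> _"
    by (rule vector_space_free_scale)
  interpret W: vector_space sW by fact
  let ?F = "free_lift sW (\<lambda>(u, v). \<beta> u v)"
  interpret F: Vector_Spaces.linear free_scale sW ?F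
    by (rule linear_free_lift) fact
  have "?F p = 0" if "p \<in> W" for p
    using that unfolding tensor_relations_def
  proof (induction rule: span_induct_alt)
    case (step c x y)
    then have "?F x = 0"
      using assms
      by (auto simp: F.diff F.scale free_lift_single[OF sW] bilinear_map_def linear_iff)
    with step show ?case
      by (simp add: F.add F.scale)
  qed (simp add: F.zero)
  then have wd: "?F p = ?F q" if "proj p = proj q" for p q
    using that proj(3) F.diff by fastforce
  \<comment> \<open>\<open>L\<close> evaluates at an arbitrary preimage; \<open>wd\<close> makes the
    choice irrelevant.\<close>
  define L where "L w = ?F (SOME p. proj p = w)" for w
  have L: "L (proj p) = ?F p" for p
    unfolding L_def by (rule wd) (rule someI[of _ p], simp)
  have lin: "proj (p + q) = proj p + proj q" "proj (free_scale c p) = sT c (proj p)" for p q c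
    using proj(1) by (simp_all add: linear_iff)
  have "L (w + w') = L w + L w'" for w w'
    using proj(2) F.add by (metis L lin(1) surjD)
  moreover have "L (sT c w) = sW c (L w)" for c w
    using proj(2) F.scale by (metis L lin(2) surjD)
  moreover have "L (t u v) = \<beta> u v" for u v
    using L[of "Poly_Mapping.single (u, v) 1"] by (simp add: proj(4) free_lift_single[OF sW])
  ultimately show ?thesis
    using sW tensor_product_vector_spaces by (auto simp: linear_iff)
qed

end

section \<open>Multilinear extension from pure tensors\<close>

text \<open>Slots described by splittings \<open>l1 @ u # l2\<close> instead of list updates fit
  list induction and the analysis of \<open>merge\<close>.\<close>

lemma multilinear_maps_iff:
  fixes g :: "'u::ab_group_add list \<Rightarrow> 'w::ab_group_add"
  shows "g \<in> multilinear_maps n s1 s2 \<longleftrightarrow>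
     (\<forall>us. length us \<noteq> n \<longrightarrow> g us = 0) \<and>
     (\<forall>l1 l2. Suc (length l1 + length l2) = n \<longrightarrow> Vector_Spaces.linear s1 s2 (\<lambda>u. g (l1 @ u # l2)))"
  (is "?L \<longleftrightarrow> ?R")
proof
  assume L: ?L
  show ?R
  proof (intro conjI allI impI)
    fix us :: "'u list" assume "length us \<noteq> n"
    then show "g us = 0" using L by (simp add: multilinear_maps_def)
  next
    fix l1 l2 :: "'u list" assume n: "Suc (length l1 + length l2) = n"
    have "Vector_Spaces.linear s1 s2 (\<lambda>u. g (us[i := u]))" if "length us = n" "i < n" for us i
      using L that by (simp add: multilinear_maps_def)
    \<comment> \<open>The entry \<open>0\<close> is a placeholder that the update
      overwrites.\<close>
    from this[of "l1 @ 0 # l2" "length l1"] n show "Vector_Spaces.linear s1 s2 (\<lambda>u. g (l1 @ u # l2))"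
      by simp
  qed
next
  assume R: ?R
  have "Vector_Spaces.linear s1 s2 (\<lambda>u. g (us[i := u]))" if "length us = n" "i < n" for us i
  proof -
    have "Vector_Spaces.linear s1 s2 (\<lambda>u. g (take i us @ u # drop (Suc i) us))"
      using R that by auto
    then show ?thesis
      using that by (simp add: upd_conv_take_nth_drop)
  qed
  with R show ?L
    by (simp add: multilinear_maps_def)
qed

lemma linear_bilinear_left:
  "bilinear_map s1 s2 s3 m \<Longrightarrow> Vector_Spaces.linear s1 s3 (\<lambda>u. m u v)"
  by (simp add: bilinear_map_def)

lemma linear_bilinear_right:
  "bilinear_map s1 s2 s3 m \<Longrightarrow> Vector_Spaces.linear s2 s3 (\<lambda>v. m u v)"
  by (simp add: bilinear_map_def)

lemma linear_add_fun:
  assumes "Vector_Spaces.linear s1 s2 f" "Vector_Spaces.linear s1 s2 g"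
  shows "Vector_Spaces.linear s1 s2 (\<lambda>x. f x + g x)"
  using assms module.scale_right_distrib[of s2] by (simp add: linear_iff module_iff_vector_space)

lemma linear_scale_fun:
  assumes "Vector_Spaces.linear s1 s2 f"
  shows "Vector_Spaces.linear s1 s2 (\<lambda>x. s2 c (f x))"
proof -
  have "vector_space s2"
    using assms by (simp add: linear_iff)
  then interpret vector_space s2 .
  show ?thesis
    using assms by (simp add: linear_iff scale_right_distrib mult.commute)
qed

lemma linear_sum_funs:
  assumes "vector_space s1" "vector_space s2" "\<And>i. i \<in> I \<Longrightarrow> Vector_Spaces.linear s1 s2 (f i)"
  shows "Vector_Spaces.linear s1 s2 (\<lambda>x. \<Sum>i\<in>I. f i x)"
proof -
  interpret vector_space s2 by fact
  show ?thesis
    using assms by (simp add: linear_iff sum.distrib scale_sum_right)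
qed

lemma bilinear_map_add_fun:
  assumes "bilinear_map s1 s2 s3 m" "bilinear_map s1 s2 s3 m'"
  shows "bilinear_map s1 s2 s3 (\<lambda>u v. m u v + m' u v)"
  using assms by (simp add: bilinear_map_def linear_add_fun)

lemma bilinear_map_scale_fun:
  assumes "bilinear_map s1 s2 s3 m"
  shows "bilinear_map s1 s2 s3 (\<lambda>u v. s3 c (m u v))"
  using assms unfolding bilinear_map_def by (auto intro: linear_scale_fun)

lemma bilinear_map_sum_funs:
  assumes "vector_space s1" "vector_space s2" "vector_space s3"
    "\<And>i. i \<in> I \<Longrightarrow> bilinear_map s1 s2 s3 (m i)"
  shows "bilinear_map s1 s2 s3 (\<lambda>u v. \<Sum>i\<in>I. m i u v)"
  using assms unfolding bilinear_map_def by (auto intro!: linear_sum_funs)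

lemma bilinear_map_comp:
  assumes "bilinear_map s1 s2 s3 m" "Vector_Spaces.linear s1' s1 f" "Vector_Spaces.linear s2' s2 g"
  shows "bilinear_map s1' s2' s3 (\<lambda>u v. m (f u) (g v))"
  using assms unfolding bilinear_map_def linear_iff by simp

text \<open>The data that extend to multilinear maps on a tensor product: the pair in each slot
  stands for a pure tensor. Wrong lengths give \<open>0\<close>, as in
  \<open>multilinear_maps\<close>.\<close>

definition multibilinear_maps ::
  "nat \<Rightarrow> ('k::field \<Rightarrow> 'u::ab_group_add \<Rightarrow> 'u) \<Rightarrow> ('k \<Rightarrow> 'v::ab_group_add \<Rightarrow> 'v) \<Rightarrow>
   ('k \<Rightarrow> 'w::ab_group_add \<Rightarrow> 'w) \<Rightarrow> (('u \<times> 'v) list \<Rightarrow> 'w) set" where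
  "multibilinear_maps n s1 s2 s3 =
     {F. (\<forall>ps. length ps \<noteq> n \<longrightarrow> F ps = 0) \<and>
         (\<forall>l1 l2. Suc (length l1 + length l2) = n \<longrightarrow>
            bilinear_map s1 s2 s3 (\<lambda>a b. F (l1 @ (a, b) # l2)))}"

lemma multibilinear_maps_Cons:
  assumes "F \<in> multibilinear_maps (Suc n) s1 s2 s3"
  shows "(\<lambda>ps. F (p # ps)) \<in> multibilinear_maps n s1 s2 s3"
proof -
  have "bilinear_map s1 s2 s3 (\<lambda>a b. F (p # l1 @ (a, b) # l2))"
    if "Suc (length l1 + length l2) = n" for l1 l2
    using assms that unfolding multibilinear_maps_def by (auto dest: spec[where x = "p # l1"])
  then show ?thesis
    using assms by (simp add: multibilinear_maps_def)
qed

text \<open>The laws hold for \<open>ps\<close> of every length, because at a wrong length both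
  sides are \<open>0\<close>; this lets them serve as plain rewrite rules.\<close>

lemma multibilinear_maps_head:
  assumes "F \<in> multibilinear_maps (Suc n) s1 s2 s3" "vector_space s3"
  shows "F ((a + a', b) # ps) = F ((a, b) # ps) + F ((a', b) # ps)"
    and "F ((a, b + b') # ps) = F ((a, b) # ps) + F ((a, b') # ps)"
    and "F ((s1 c a, b) # ps) = s3 c (F ((a, b) # ps))"
    and "F ((a, s2 c b) # ps) = s3 c (F ((a, b) # ps))"
proof -
  interpret vector_space s3 by fact
  have "bilinear_map s1 s2 s3 (\<lambda>a b. F ([] @ (a, b) # ps))" if "length ps = n"
    using assms that unfolding multibilinear_maps_def by (auto dest: spec[where x = "[]"])
  moreover have "F (p # ps) = 0" if "length ps \<noteq> n" for p
    using assms that by (simp add: multibilinear_maps_def)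
  ultimately show "F ((a + a', b) # ps) = F ((a, b) # ps) + F ((a', b) # ps)"
    and "F ((a, b + b') # ps) = F ((a, b) # ps) + F ((a, b') # ps)"
    and "F ((s1 c a, b) # ps) = s3 c (F ((a, b) # ps))"
    and "F ((a, s2 c b) # ps) = s3 c (F ((a, b) # ps))"
    by (cases "length ps = n"; simp add: bilinear_map_def linear_iff)+
qed

section \<open>Lifting bilinear and multilinear maps to tensor products\<close>

context tensor_product
begin

definition tensor_lift ::
  "('k \<Rightarrow> 'w::ab_group_add \<Rightarrow> 'w) \<Rightarrow> ('u \<Rightarrow> 'v \<Rightarrow> 'w) \<Rightarrow> 't \<Rightarrow> 'w" where
  "tensor_lift sW \<beta> = (SOME L. Vector_Spaces.linear sT sW L \<and> (\<forall>u v. L (t u v) = \<beta> u v))"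

lemma tensor_lift:
  assumes "bilinear_map s1 s2 sW \<beta>"
  shows "Vector_Spaces.linear sT sW (tensor_lift sW \<beta>)" "tensor_lift sW \<beta> (t u v) = \<beta> u v"
  using someI_ex[OF tensor_lift_exists[OF assms]] by (simp_all add: tensor_lift_def)

lemma tensor_lift_eqI:
  assumes "bilinear_map s1 s2 sW \<beta>" "Vector_Spaces.linear sT sW L" "\<And>u v. L (t u v) = \<beta> u v"
  shows "tensor_lift sW \<beta> = L"
  using assms by (intro linear_eq_on_tensors[OF tensor_lift(1)]) (simp_all add: tensor_lift(2))

text \<open>Together with the scaling law, this says that the lift depends linearly on the bilinear
  map, which is what makes nested lifts linear in the inner variables.\<close>

lemma tensor_lift_add:
  assumes "bilinear_map s1 s2 sW \<beta>" "bilinear_map s1 s2 sW \<beta>'"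
  shows "tensor_lift sW (\<lambda>u v. \<beta> u v + \<beta>' u v) = (\<lambda>r. tensor_lift sW \<beta> r + tensor_lift sW \<beta>' r)"
  using assms by (intro tensor_lift_eqI)
    (simp_all add: tensor_lift linear_add_fun bilinear_map_add_fun)

lemma tensor_lift_scale:
  assumes "bilinear_map s1 s2 sW \<beta>"
  shows "tensor_lift sW (\<lambda>u v. sW c (\<beta> u v)) = (\<lambda>r. sW c (tensor_lift sW \<beta> r))"
  using assms by (intro tensor_lift_eqI)
    (simp_all add: tensor_lift linear_scale_fun bilinear_map_scale_fun)

text \<open>Lift in the primed variables first, then lift the result in the unprimed ones. Unique
  existence is what the \<open>THE\<close> in \<open>tensor_alg\<close> and
  \<open>tensor_bimod\<close> requires, for the product and for both actions.\<close>

lemma bilinear_tensor_lift_ex1: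
  assumes tp': "tensor_product s1' s2' sT' t'"
    and \<gamma>: "\<And>u' v'. bilinear_map s1 s2 sW (\<lambda>u v. \<gamma> u v u' v')"
      "\<And>u v. bilinear_map s1' s2' sW (\<lambda>u' v'. \<gamma> u v u' v')"
  shows "\<exists>!m. bilinear_map sT sT' sW m \<and> (\<forall>u v u' v'. m (t u v) (t' u' v') = \<gamma> u v u' v')"
proof (rule ex_ex1I)
  interpret T': tensor_product s1' s2' sT' t' by fact
  have vs: "vector_space sT" "vector_space sT'" "vector_space sW"
    using \<gamma>(1) tensor_product_vector_spaces T'.tensor_product_vector_spaces
    by (auto simp: bilinear_map_def linear_iff)
  let ?\<beta> = "\<lambda>r' u v. T'.tensor_lift sW (\<gamma> u v) r'"
  note lift'_lin = T'.tensor_lift(1)[OF \<gamma>(2), unfolded linear_iff, THEN conjunct2, THEN conjunct2]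
  have lift'_add: "?\<beta> (r + r') u v = ?\<beta> r u v + ?\<beta> r' u v" for r r' u v
    using lift'_lin by blast
  have lift'_scale: "?\<beta> (sT' c r) u v = sW c (?\<beta> r u v)" for c r u v
    using lift'_lin by blast
  have add: "\<gamma> (u + w) v = (\<lambda>u' v'. \<gamma> u v u' v' + \<gamma> w v u' v')"
    "\<gamma> u (v + x) = (\<lambda>u' v'. \<gamma> u v u' v' + \<gamma> u x u' v')"
    "\<gamma> (s1 c u) v = (\<lambda>u' v'. sW c (\<gamma> u v u' v'))"
    "\<gamma> u (s2 c v) = (\<lambda>u' v'. sW c (\<gamma> u v u' v'))" for u w v x c
    using \<gamma>(1) by (simp_all add: bilinear_map_def linear_iff fun_eq_iff)
  have bil: "bilinear_map s1 s2 sW (?\<beta> r')" for r'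
    using tensor_product_vector_spaces vs
    by (intro bilinear_mapI) (simp_all add: add T'.tensor_lift_add T'.tensor_lift_scale \<gamma>(2))
  let ?m = "\<lambda>r r'. tensor_lift sW (?\<beta> r') r"
  have "bilinear_map sT sT' sW ?m"
  proof (rule bilinear_mapI[OF vs])
    show "?m (r + r') x = ?m r x + ?m r' x" "?m (sT c r) x = sW c (?m r x)" for r r' x c
      using tensor_lift(1)[OF bil] by (simp_all add: linear_iff)
    show "?m r (x + y) = ?m r x + ?m r y" "?m r (sT' c x) = sW c (?m r x)" for r x y c
      by (simp_all only: lift'_add lift'_scale tensor_lift_add[OF bil bil] tensor_lift_scale[OF bil])
  qed
  moreover have "?m (t u v) (t' u' v') = \<gamma> u v u' v'" for u v u' v'
    by (rule trans[OF tensor_lift(2)[OF bil] T'.tensor_lift(2)[OF \<gamma>(2)]])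
  ultimately show "\<exists>m. bilinear_map sT sT' sW m \<and> (\<forall>u v u' v'. m (t u v) (t' u' v') = \<gamma> u v u' v')"
    by blast
next
  interpret T': tensor_product s1' s2' sT' t' by fact
  fix m m'
  assume m: "bilinear_map sT sT' sW m \<and> (\<forall>u v u' v'. m (t u v) (t' u' v') = \<gamma> u v u' v')"
    and m': "bilinear_map sT sT' sW m' \<and> (\<forall>u v u' v'. m' (t u v) (t' u' v') = \<gamma> u v u' v')"
  have eq: "m (t u v) = m' (t u v)" for u v
    using m m' by (intro T'.linear_eq_on_tensors[where sW = sW]) (auto simp: bilinear_map_def)
  have "(\<lambda>r. m r r') = (\<lambda>r. m' r r')" for r'
    using m m' by (intro linear_eq_on_tensors[where sW = sW]) (auto simp: bilinear_map_def eq)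
  then show "m = m'"
    by (meson ext fun_cong)
qed

text \<open>Slots are reduced to pure tensors one at a time: the induction runs over the remaining
  tail, with an arbitrary prefix that already consists of pure tensors.\<close>

lemma multilinear_eq_on_tensors:
  assumes "g \<in> multilinear_maps n sT sW" "h \<in> multilinear_maps n sT sW"
    and "\<And>ps. length ps = n \<Longrightarrow> g (map (\<lambda>(u, v). t u v) ps) = h (map (\<lambda>(u, v). t u v) ps)"
  shows "g = h"
proof
  fix rs
  have "g (map (\<lambda>(u, v). t u v) ps @ rs) = h (map (\<lambda>(u, v). t u v) ps @ rs)"
    if "length ps + length rs = n" for ps
    using that
  proof (induction rs arbitrary: ps)
    case Nil
    then show ?case using assms(3) by simp
  next
    case (Cons r rs)
    let ?l = "map (\<lambda>(u, v). t u v) ps"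
    have "(\<lambda>r. g (?l @ r # rs)) = (\<lambda>r. h (?l @ r # rs))"
    proof (rule linear_eq_on_tensors)
      show "Vector_Spaces.linear sT sW (\<lambda>r. g (?l @ r # rs))"
        "Vector_Spaces.linear sT sW (\<lambda>r. h (?l @ r # rs))"
        using assms(1,2) Cons.prems by (simp_all add: multilinear_maps_iff)
      show "g (?l @ t u v # rs) = h (?l @ t u v # rs)" for u v
        using Cons.IH[of "ps @ [(u, v)]"] Cons.prems by simp
    qed
    then show ?case by (rule fun_cong)
  qed
  from this[of "[]"] show "g rs = h rs"
    using assms(1,2) by (cases "length rs = n") (simp_all add: multilinear_maps_def)
qed

text \<open>Iterating the binary lift from the head of the list avoids forming an
  \<open>n\<close>-fold tensor product.\<close>

fun multi_lift ::
  "('k \<Rightarrow> 'w::ab_group_add \<Rightarrow> 'w) \<Rightarrow> (('u \<times> 'v) list \<Rightarrow> 'w) \<Rightarrow> 't list \<Rightarrow> 'w" where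
  "multi_lift sW F [] = F []"
| "multi_lift sW F (r # rs) = tensor_lift sW (\<lambda>u v. multi_lift sW (\<lambda>ps. F ((u, v) # ps)) rs) r"

text \<open>The three claims need a joint induction: linearity in the map for the tail gives
  bilinearity in the head pair, and that allows \<open>tensor_lift_add\<close> and
  \<open>tensor_lift_scale\<close> to be applied to the whole list.\<close>

lemma multi_lift_linear_in_map:
  assumes "vector_space sW"
    and "F \<in> multibilinear_maps (length rs) s1 s2 sW" "G \<in> multibilinear_maps (length rs) s1 s2 sW"
  shows "multi_lift sW (\<lambda>ps. F ps + G ps) rs = multi_lift sW F rs + multi_lift sW G rs"
    and "multi_lift sW (\<lambda>ps. sW c (F ps)) rs = sW c (multi_lift sW F rs)"
    and "rs = r' # rs' \<Longrightarrow> bilinear_map s1 s2 sW (\<lambda>u v. multi_lift sW (\<lambda>ps. F ((u, v) # ps)) rs')"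
  using assms(2,3)
proof (induction rs arbitrary: F G c r' rs')
  case (Cons r rs)
  have bil: "bilinear_map s1 s2 sW (\<lambda>u v. multi_lift sW (\<lambda>ps. F ((u, v) # ps)) rs)"
    if F: "F \<in> multibilinear_maps (length (r # rs)) s1 s2 sW" for F
  proof -
    have F': "F \<in> multibilinear_maps (Suc (length rs)) s1 s2 sW"
      using F by simp
    note mem = multibilinear_maps_Cons[OF F']
    show ?thesis
      using tensor_product_vector_spaces assms(1)
      by (intro bilinear_mapI)
        (simp_all only: multibilinear_maps_head[OF F' assms(1)] Cons.IH(1)[OF mem mem] Cons.IH(2)[OF mem mem])
  qed
  {
    case 1
    have mem: "(\<lambda>ps. F (p # ps)) \<in> multibilinear_maps (length rs) s1 s2 sW"
      "(\<lambda>ps. G (p # ps)) \<in> multibilinear_maps (length rs) s1 s2 sW" for p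
      using 1 by (auto intro: multibilinear_maps_Cons)
    show ?case
      by (simp only: multi_lift.simps Cons.IH(1)[OF mem] tensor_lift_add[OF bil[OF 1(1)] bil[OF 1(2)]])
  next
    case 2
    have mem: "(\<lambda>ps. F (p # ps)) \<in> multibilinear_maps (length rs) s1 s2 sW" for p
      using 2 by (auto intro: multibilinear_maps_Cons)
    show ?case
      by (simp only: multi_lift.simps Cons.IH(2)[OF mem mem] tensor_lift_scale[OF bil[OF 2(1)]])
  next
    case 3
    then show ?case using bil by simp
  }
qed simp_all

text \<open>In the head slot this is linearity of a lift; a later slot enters through the lifted
  bilinear map, on which the lift depends linearly.\<close>

lemma multi_lift_linear:
  assumes "vector_space sW" "F \<in> multibilinear_maps (Suc (length l1 + length l2)) s1 s2 sW"
  shows "Vector_Spaces.linear sT sW (\<lambda>r. multi_lift sW F (l1 @ r # l2))"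
  using assms(2)
proof (induction l1 arbitrary: F)
  case Nil
  show ?case
    \<comment> \<open>The head entry only supplies the length of the list; its value does not enter
      the bilinearity claim.\<close>
    using multi_lift_linear_in_map(3)[OF assms(1), where rs = "undefined # l2" and F = F] Nil
    by (simp add: tensor_lift(1))
next
  case (Cons x l1)
  have bil: "bilinear_map s1 s2 sW (\<lambda>u v. multi_lift sW (\<lambda>ps. F ((u, v) # ps)) (l1 @ r # l2))" for r
    using multi_lift_linear_in_map(3)[OF assms(1), where rs = "x # l1 @ r # l2" and F = F] Cons.prems
    by simp
  have lin: "Vector_Spaces.linear sT sW (\<lambda>r. multi_lift sW (\<lambda>ps. F ((u, v) # ps)) (l1 @ r # l2))" for u v
    using Cons.prems by (intro Cons.IH multibilinear_maps_Cons) simp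
  have
    "multi_lift sW (\<lambda>ps. F ((u, v) # ps)) (l1 @ (r + r') # l2) =
      multi_lift sW (\<lambda>ps. F ((u, v) # ps)) (l1 @ r # l2) + multi_lift sW (\<lambda>ps. F ((u, v) # ps)) (l1 @ r' # l2)"
    "multi_lift sW (\<lambda>ps. F ((u, v) # ps)) (l1 @ sT c r # l2) =
      sW c (multi_lift sW (\<lambda>ps. F ((u, v) # ps)) (l1 @ r # l2))" for u v r r' c
    using lin[of u v] by (auto simp: linear_iff)
  then show ?case
    using tensor_product_vector_spaces assms(1)
    by (simp add: linear_iff tensor_lift_add[OF bil bil] tensor_lift_scale[OF bil])
qed

lemma multi_lift_tensors:
  assumes "vector_space sW" "F \<in> multibilinear_maps (length ps) s1 s2 sW"
  shows "multi_lift sW F (map (\<lambda>(u, v). t u v) ps) = F ps"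
  using assms(2)
proof (induction ps arbitrary: F)
  case (Cons p ps)
  obtain u v where p: "p = (u, v)" by (cases p)
  have "bilinear_map s1 s2 sW (\<lambda>u v. multi_lift sW (\<lambda>qs. F ((u, v) # qs)) (map (\<lambda>(u, v). t u v) ps))"
    using multi_lift_linear_in_map(3)[OF assms(1), where rs = "map (\<lambda>(u, v). t u v) (p # ps)" and F = F]
      Cons.prems by simp
  moreover have "(\<lambda>qs. F ((u, v) # qs)) \<in> multibilinear_maps (length ps) s1 s2 sW"
    using Cons.prems by (intro multibilinear_maps_Cons) simp
  ultimately show ?case
    using Cons.IH by (simp add: p tensor_lift(2))
qed simp

lemma multilinear_extension_exists:
  assumes "vector_space sW" "F \<in> multibilinear_maps n s1 s2 sW"
  obtains g where "g \<in> multilinear_maps n sT sW"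
    "\<And>ps. length ps = n \<Longrightarrow> g (map (\<lambda>(u, v). t u v) ps) = F ps"
proof
  let ?g = "\<lambda>rs. if length rs = n then multi_lift sW F rs else 0"
  show "?g \<in> multilinear_maps n sT sW"
    using assms by (auto simp: multilinear_maps_iff intro: multi_lift_linear)
  show "?g (map (\<lambda>(u, v). t u v) ps) = F ps" if "length ps = n" for ps
    using that assms multi_lift_tensors[OF assms(1)] by auto
qed

end

section \<open>Perm algebras\<close>

text \<open>Multiplicativity is required only on words in the supports. This matters for
  \<open>initial_coeff\<close>, whose product rule fails when the left word is empty.\<close>

lemma free_lift_mult:
  fixes p q :: "'x list \<Rightarrow>\<^sub>0 'k::field"
  assumes "\<And>u v. u \<in> Poly_Mapping.keys p \<Longrightarrow> v \<in> Poly_Mapping.keys q \<Longrightarrow> h (u + v) = h1 u * h2 v"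
  shows "free_lift (*) h (p * q) = free_lift (*) h1 p * free_lift (*) h2 q"
proof -
  note lin = linear_sum_fun[OF linear_free_lift[OF vector_space_mult]]
  have "p * q = (\<Sum>u\<in>Poly_Mapping.keys p. \<Sum>v\<in>Poly_Mapping.keys q.
      Poly_Mapping.single (u + v) (Poly_Mapping.lookup p u * Poly_Mapping.lookup q v))"
    by (subst (1) poly_mapping_eq_sum_single[of p], subst (1) poly_mapping_eq_sum_single[of q])
      (simp only: sum_product mult_single)
  then have "free_lift (*) h (p * q) = (\<Sum>u\<in>Poly_Mapping.keys p. \<Sum>v\<in>Poly_Mapping.keys q.
      Poly_Mapping.lookup p u * Poly_Mapping.lookup q v * h (u + v))"
    by (simp add: lin free_lift_single[OF vector_space_mult])
  also have "\<dots> = (\<Sum>u\<in>Poly_Mapping.keys p. \<Sum>v\<in>Poly_Mapping.keys q.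
      (Poly_Mapping.lookup p u * h1 u) * (Poly_Mapping.lookup q v * h2 v))"
    by (intro sum.cong) (simp_all add: assms)
  also have "\<dots> = free_lift (*) h1 p * free_lift (*) h2 q"
    by (simp only: free_lift_def sum_product)
  finally show ?thesis .
qed

lemma free_scale_mult_left:
  fixes p q :: "'x list \<Rightarrow>\<^sub>0 'k::field"
  shows "free_scale c p * q = free_scale c (p * q)"
  by (simp add: free_scale_def mult_map_scale_conv_mult mult.assoc)

lemma free_scale_mult_right:
  fixes p q :: "'x list \<Rightarrow>\<^sub>0 'k::field"
  shows "p * free_scale c q = free_scale c (p * q)"
proof -
  \<comment> \<open>Here \<open>0\<close> is the empty word, so \<open>single 0 c\<close> is a
    constant and central although words do not commute.\<close>
  have comm: "r * Poly_Mapping.single 0 c = Poly_Mapping.single 0 c * r" for r :: "'x list \<Rightarrow>\<^sub>0 'k"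
    by (subst (1 2) poly_mapping_eq_sum_single[of r])
      (simp add: sum_distrib_left sum_distrib_right mult_single mult.commute)
  show ?thesis
    by (simp only: free_scale_def mult_map_scale_conv_mult mult.assoc[symmetric] comm)
qed

section \<open>The free algebra, the Perm ideal and functionals vanishing on it\<close>

lemma free_assoc_zero: "0 \<in> free_assoc X"
  by (simp add: free_assoc_def)

lemma free_assoc_add: "p \<in> free_assoc X \<Longrightarrow> q \<in> free_assoc X \<Longrightarrow> p + q \<in> free_assoc X"
  using Poly_Mapping.keys_add[of p q] by (auto simp: free_assoc_def)

lemma free_assoc_scale: "p \<in> free_assoc X \<Longrightarrow> free_scale c p \<in> free_assoc X"
  by (auto simp: free_assoc_def in_keys_iff)

lemma free_assoc_diff:
  fixes p q :: "'x list \<Rightarrow>\<^sub>0 'k::field"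
  assumes "p \<in> free_assoc X" "q \<in> free_assoc X"
  shows "p - q \<in> free_assoc X"
proof -
  have "Poly_Mapping.keys (p - q) \<subseteq> Poly_Mapping.keys p \<union> Poly_Mapping.keys q"
    by (auto simp: in_keys_iff lookup_minus)
  then show ?thesis
    using assms by (auto simp: free_assoc_def)
qed

lemma free_assoc_mult:
  fixes p q :: "'x list \<Rightarrow>\<^sub>0 'k::field"
  shows "p \<in> free_assoc X \<Longrightarrow> q \<in> free_assoc X \<Longrightarrow> p * q \<in> free_assoc X"
  using Poly_Mapping.keys_mult[of p q] by (fastforce simp: free_assoc_def plus_list_def)

lemma free_assoc_single: "x \<in> X \<Longrightarrow> Poly_Mapping.single [x] 1 \<in> free_assoc X"
  by (simp add: free_assoc_def)

lemma perm_ideal_uminus: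
  fixes p :: "'x list \<Rightarrow>\<^sub>0 'k::field"
  assumes "p \<in> perm_ideal X"
  shows "- p \<in> perm_ideal X"
proof -
  have "- p = free_scale (-1) p"
    by (rule poly_mapping_eqI) simp
  then show ?thesis
    using assms by (simp add: perm_ideal.scale)
qed

text \<open>Needed for right multiples in the ideal: \<open>initial_coeff_mult\<close> applies only
  to a left factor without constant term.\<close>

lemma perm_ideal_subset: "p \<in> perm_ideal X \<Longrightarrow> p \<in> free_assoc X"
  by (induction rule: perm_ideal.induct)
    (auto intro: free_assoc_zero free_assoc_add free_assoc_scale free_assoc_diff free_assoc_mult)

definition augmentation :: "('x list \<Rightarrow>\<^sub>0 'k::field) \<Rightarrow> 'k" where
  "augmentation = free_lift (*) (\<lambda>_. 1)"

definition initial_coeff :: "'x \<Rightarrow> ('x list \<Rightarrow>\<^sub>0 'k::field) \<Rightarrow> 'k" where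
  "initial_coeff x = free_lift (*) (\<lambda>w. if w \<noteq> [] \<and> hd w = x then 1 else 0)"

lemma linear_augmentation: "Vector_Spaces.linear free_scale (*) augmentation"
  unfolding augmentation_def by (rule linear_free_lift[OF vector_space_mult])

lemma linear_initial_coeff: "Vector_Spaces.linear free_scale (*) (initial_coeff x)"
  unfolding initial_coeff_def by (rule linear_free_lift[OF vector_space_mult])

lemma augmentation_mult: "augmentation (p * q) = augmentation p * augmentation q"
  unfolding augmentation_def by (rule free_lift_mult) simp

text \<open>The words of \<open>p\<close> are nonempty, so a concatenation starts with the first
  letter of its left part.\<close>

lemma initial_coeff_mult:
  "p \<in> free_assoc X \<Longrightarrow> initial_coeff x (p * q) = initial_coeff x p * augmentation q"
  unfolding initial_coeff_def augmentation_def
  by (rule free_lift_mult) (auto simp: free_assoc_def plus_list_def)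

text \<open>On a generator both products have the same first factor, and the augmentation takes
  commuting values. The claims are proved together because \<open>initial_coeff\<close> of a left
  multiple \<open>u * p\<close> is governed by the augmentation of \<open>p\<close>.\<close>

lemma functionals_vanish_on_perm_ideal:
  fixes p :: "'x list \<Rightarrow>\<^sub>0 'k::field"
  assumes "p \<in> perm_ideal X"
  shows "augmentation p = 0" "initial_coeff x p = 0"
proof -
  note lin = linear_simps[OF linear_augmentation] linear_simps[OF linear_initial_coeff]
  have "augmentation p = 0 \<and> initial_coeff x p = 0"
    using assms
  proof (induction rule: perm_ideal.induct)
    case (right p u)
    then show ?case
      using initial_coeff_mult[OF perm_ideal_subset, of p X x u] by (simp add: augmentation_mult)
  next
    case (gen u v w)
    then show ?case
      by (simp add: lin augmentation_mult initial_coeff_mult[where X = X] mult.commute)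
  next
    case (left u p)
    then show ?case
      by (simp add: augmentation_mult initial_coeff_mult[where X = X])
  qed (simp_all add: lin)
  then show "augmentation p = 0" "initial_coeff x p = 0"
    by auto
qed

text \<open>Given associativity, \<open>mul_right_commute\<close> is equivalent to a(bc) = a(cb);
  this form says that right multiplications commute, which suits left-nested products.\<close>

locale perm_algebra =
  fixes A :: "('k::field, 'a::ab_group_add) alg"
  assumes vector_space: "vector_space (scl A)"
    and bilinear_mul: "bilinear_map (scl A) (scl A) (scl A) (mul A)"
    and mul_assoc: "mul A (mul A a b) c = mul A a (mul A b c)"
    and mul_right_commute: "mul A (mul A a b) c = mul A (mul A a c) b"

text \<open>A presentation of \<open>A\<close> by representatives instead of cosets. Values of \<pi>
  outside \<open>free_assoc X\<close> are unconstrained.\<close>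

definition perm_projection ::
  "'x set \<Rightarrow> ('k::field, 'a::ab_group_add) alg \<Rightarrow> (('x list \<Rightarrow>\<^sub>0 'k) \<Rightarrow> 'a) \<Rightarrow> bool" where
  "perm_projection X A \<pi> \<longleftrightarrow>
     (\<forall>a. \<exists>p\<in>free_assoc X. a = \<pi> p) \<and>
     (\<forall>p\<in>free_assoc X. \<forall>q\<in>free_assoc X.
        (\<pi> p = \<pi> q \<longleftrightarrow> p - q \<in> perm_ideal X) \<and>
        \<pi> (p + q) = \<pi> p + \<pi> q \<and> \<pi> (p * q) = mul A (\<pi> p) (\<pi> q)) \<and>
     (\<forall>c. \<forall>p\<in>free_assoc X. \<pi> (free_scale c p) = scl A c (\<pi> p))"

lemma perm_projectionD:
  assumes "perm_projection X A \<pi>"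
  shows "\<exists>p\<in>free_assoc X. a = \<pi> p"
    and "p \<in> free_assoc X \<Longrightarrow> q \<in> free_assoc X \<Longrightarrow> \<pi> p = \<pi> q \<longleftrightarrow> p - q \<in> perm_ideal X"
    and "p \<in> free_assoc X \<Longrightarrow> q \<in> free_assoc X \<Longrightarrow> \<pi> p + \<pi> q = \<pi> (p + q)"
    and "p \<in> free_assoc X \<Longrightarrow> q \<in> free_assoc X \<Longrightarrow> mul A (\<pi> p) (\<pi> q) = \<pi> (p * q)"
    and "p \<in> free_assoc X \<Longrightarrow> scl A c (\<pi> p) = \<pi> (free_scale c p)"
  using assms by (simp_all add: perm_projection_def)

lemma free_perm_algebra_projection:
  fixes X :: "'x set" and A :: "('k::field, 'a::ab_group_add) alg"
  assumes "free_perm_algebra X A"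
  obtains \<pi> :: "('x list \<Rightarrow>\<^sub>0 'k) \<Rightarrow> 'a" where "perm_projection X A \<pi>"
proof -
  let ?V = "free_assoc X :: ('x list \<Rightarrow>\<^sub>0 'k) set"
  obtain \<phi> where iso: "quotient_iso free_scale ?V (perm_ideal X) (scl A) \<phi>"
    and mult: "\<And>p q. p \<in> ?V \<Longrightarrow> q \<in> ?V \<Longrightarrow> \<phi> (coset_of ?V (perm_ideal X) (p * q)) =
      mul A (\<phi> (coset_of ?V (perm_ideal X) p)) (\<phi> (coset_of ?V (perm_ideal X) q))"
    using assms by (auto simp: free_perm_algebra_def)
  have "\<exists>p\<in>?V. a = \<phi> (coset_of ?V (perm_ideal X) p)" for a
    using quotient_iso_surj[OF iso] by metis
  moreover have "\<phi> (coset_of ?V (perm_ideal X) p) = \<phi> (coset_of ?V (perm_ideal X) q) \<longleftrightarrow> p - q \<in> perm_ideal X"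
    if "p \<in> ?V" "q \<in> ?V" for p q
    using quotient_iso_eqD[OF iso that perm_ideal.zero]
      quotient_iso_cong[OF that _ perm_ideal.add perm_ideal_uminus]
    by blast
  ultimately have "perm_projection X A (\<lambda>p. \<phi> (coset_of ?V (perm_ideal X) p))"
    using iso mult by (simp add: perm_projection_def quotient_iso_def)
  then show thesis
    by (rule that)
qed

lemma perm_algebra_free_perm_algebra:
  fixes X :: "'x set" and A :: "('k::field, 'a::ab_group_add) alg"
  assumes "free_perm_algebra X A"
  shows "perm_algebra A"
proof -
  have vs: "vector_space (scl A)"
    using assms by (simp add: free_perm_algebra_def)
  obtain \<pi> :: "('x list \<Rightarrow>\<^sub>0 'k) \<Rightarrow> 'a" where \<pi>: "perm_projection X A \<pi>"
    by (rule free_perm_algebra_projection[OF assms])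
  note hom = perm_projectionD(3-5)[OF \<pi>] free_assoc_add free_assoc_scale free_assoc_mult
  have "\<exists>p. p \<in> free_assoc X \<and> a = \<pi> p" for a
    using perm_projectionD(1)[OF \<pi>] by blast
  then obtain \<sigma> where \<sigma>: "\<And>a. \<sigma> a \<in> free_assoc X" "\<And>a. a = \<pi> (\<sigma> a)"
    by metis
  have \<pi>_laws: "mul A (\<pi> p + \<pi> q) (\<pi> r) = mul A (\<pi> p) (\<pi> r) + mul A (\<pi> q) (\<pi> r)"
    "mul A (\<pi> p) (\<pi> q + \<pi> r) = mul A (\<pi> p) (\<pi> q) + mul A (\<pi> p) (\<pi> r)"
    "mul A (scl A k (\<pi> p)) (\<pi> q) = scl A k (mul A (\<pi> p) (\<pi> q))"
    "mul A (\<pi> p) (scl A k (\<pi> q)) = scl A k (mul A (\<pi> p) (\<pi> q))"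
    "mul A (mul A (\<pi> p) (\<pi> q)) (\<pi> r) = mul A (\<pi> p) (mul A (\<pi> q) (\<pi> r))"
    "mul A (mul A (\<pi> p) (\<pi> q)) (\<pi> r) = mul A (mul A (\<pi> p) (\<pi> r)) (\<pi> q)"
    if "p \<in> free_assoc X" "q \<in> free_assoc X" "r \<in> free_assoc X" for p q r k
    using that by (simp_all add: hom distrib_left distrib_right free_scale_mult_left
        free_scale_mult_right mult.assoc perm_projectionD(2)[OF \<pi>] perm_ideal.gen)
  \<comment> \<open>Every element is replaced by its chosen representative, and folding turns
    \<open>\<pi> (\<sigma> a)\<close> back into \<open>a\<close>.\<close>
  note laws = \<pi>_laws[OF \<sigma>(1) \<sigma>(1) \<sigma>(1), folded \<sigma>(2)]
  show ?thesis
    by (rule perm_algebra.intro) (rule vs bilinear_mapI laws)+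
qed

text \<open>Evaluating \<open>h\<close> at any representative is well defined, since two
  representatives differ by an element of the ideal.\<close>

lemma free_perm_algebra_functional:
  fixes X :: "'x set" and A :: "('k::field, 'a::ab_group_add) alg" and h :: "('x list \<Rightarrow>\<^sub>0 'k) \<Rightarrow> 'k"
  assumes vs: "vector_space (scl A)"
    and "Vector_Spaces.linear free_scale (*) h" "\<And>p. p \<in> perm_ideal X \<Longrightarrow> h p = 0"
    and \<pi>: "perm_projection X A \<pi>"
  obtains \<mu> where "Vector_Spaces.linear (scl A) (*) \<mu>" "\<And>p. p \<in> free_assoc X \<Longrightarrow> \<mu> (\<pi> p) = h p"
proof -
  interpret h: Vector_Spaces.linear free_scale "(*)" h by fact
  define \<mu> where "\<mu> a = h (SOME p. p \<in> free_assoc X \<and> \<pi> p = a)" for a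
  have \<mu>: "\<mu> (\<pi> p) = h p" if "p \<in> free_assoc X" for p
  proof -
    let ?q = "SOME q. q \<in> free_assoc X \<and> \<pi> q = \<pi> p"
    have q: "?q \<in> free_assoc X \<and> \<pi> ?q = \<pi> p"
      by (rule someI[of _ p]) (simp add: that)
    then have "h (?q - p) = 0"
      using that perm_projectionD(2)[OF \<pi>] assms(3) by blast
    then show ?thesis
      by (simp add: h.diff \<mu>_def)
  qed
  moreover have "Vector_Spaces.linear (scl A) (*) \<mu>"
    unfolding linear_iff
  proof (intro conjI allI)
    fix a b c
    obtain p q where [simp]: "p \<in> free_assoc X" "q \<in> free_assoc X" "a = \<pi> p" "b = \<pi> q"
      using perm_projectionD(1)[OF \<pi>, of a] perm_projectionD(1)[OF \<pi>, of b] by blast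
    show "\<mu> (a + b) = \<mu> a + \<mu> b"
      by (simp add: perm_projectionD(3)[OF \<pi>] \<mu> free_assoc_add h.add)
    show "\<mu> (scl A c a) = c * \<mu> a"
      by (simp add: perm_projectionD(5)[OF \<pi>] \<mu> free_assoc_scale h.scale)
  qed (simp_all add: vs vector_space_mult)
  ultimately show thesis
    using that by blast
qed

text \<open>Everything that injectivity takes from freeness: \<open>a\<close> and \<open>b\<close>
  are the classes of \<open>x\<close> and \<open>y\<close>, \<mu> comes from
  \<open>initial_coeff x\<close> and \<epsilon> from the augmentation. That \<open>x\<close> and
  \<open>y\<close> differ yields \<open>\<mu> b = 0\<close>.\<close>

lemma free_perm_algebra_initial_functional:
  fixes X :: "'x set" and A :: "('k::field, 'a::ab_group_add) alg"
  assumes "free_perm_algebra X A" "x \<in> X" "y \<in> X" "x \<noteq> y"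
  obtains \<mu> \<epsilon> a b where "Vector_Spaces.linear (scl A) (*) \<mu>"
    "\<And>c d. \<mu> (mul A c d) = \<mu> c * \<epsilon> d" "\<mu> a = 1" "\<epsilon> a = 1" "\<mu> b = 0" "\<epsilon> b = 1"
proof -
  have vs: "vector_space (scl A)"
    using assms by (simp add: free_perm_algebra_def)
  obtain \<pi> :: "('x list \<Rightarrow>\<^sub>0 'k) \<Rightarrow> 'a" where \<pi>: "perm_projection X A \<pi>"
    by (rule free_perm_algebra_projection[OF assms(1)])
  obtain \<epsilon> where \<epsilon>: "\<And>p. p \<in> free_assoc X \<Longrightarrow> \<epsilon> (\<pi> p) = augmentation p"
    by (rule free_perm_algebra_functional[OF vs linear_augmentation _ \<pi>])
      (auto simp: functionals_vanish_on_perm_ideal)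
  obtain \<mu> where lin: "Vector_Spaces.linear (scl A) (*) \<mu>"
    and \<mu>: "\<And>p. p \<in> free_assoc X \<Longrightarrow> \<mu> (\<pi> p) = initial_coeff x p"
    by (rule free_perm_algebra_functional[OF vs linear_initial_coeff _ \<pi>])
      (auto simp: functionals_vanish_on_perm_ideal)
  have "\<mu> (mul A c d) = \<mu> c * \<epsilon> d" for c d
  proof -
    obtain p q where [simp]: "p \<in> free_assoc X" "q \<in> free_assoc X" "c = \<pi> p" "d = \<pi> q"
      using perm_projectionD(1)[OF \<pi>] by metis
    show ?thesis
      by (simp add: perm_projectionD(4)[OF \<pi>] \<mu> \<epsilon> free_assoc_mult initial_coeff_mult[where X = X])
  qed
  then show thesis
    using that[of \<mu> \<epsilon> "\<pi> (Poly_Mapping.single [x] 1)" "\<pi> (Poly_Mapping.single [y] 1)"] lin assms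
    by (simp add: \<mu> \<epsilon> free_assoc_single initial_coeff_def augmentation_def
        free_lift_single[OF vector_space_mult])
qed

section \<open>Left-nested products in a Perm algebra\<close>

context perm_algebra
begin

text \<open>Right multiplications commute pairwise, so all factors after the first may be permuted
  freely.\<close>

lemma foldl_mul_mset_cong:
  assumes "mset xs = mset ys"
  shows "foldl (mul A) a xs = foldl (mul A) a ys"
proof -
  have "fold (\<lambda>x a. mul A a x) xs = fold (\<lambda>x a. mul A a x) ys"
    using assms by (intro fold_multiset_equiv) (auto simp: fun_eq_iff mul_right_commute)
  then show ?thesis
    by (simp add: foldl_conv_fold)
qed

lemma mul_foldl: "mul A a (foldl (mul A) b xs) = foldl (mul A) a (b # xs)"
  by (induction xs rule: rev_induct) (simp_all flip: mul_assoc)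

text \<open>Replaces the one-based index by a splitting of the list: a prefix of length
  \<open>r\<close> precedes the leading factor number \<open>Suc r\<close>.\<close>

lemma perm_product_append:
  "length p = r \<Longrightarrow> perm_product A (Suc r) (p @ a # q) = foldl (mul A) a (rev p @ q)"
  by (auto simp: perm_product_def)

lemma linear_foldl_start: "Vector_Spaces.linear (scl A) (scl A) (\<lambda>a. foldl (mul A) a xs)"
proof (induction xs rule: rev_induct)
  case Nil
  then show ?case using vector_space by (simp add: linear_iff)
next
  case (snoc x xs)
  have "Vector_Spaces.linear (scl A) (scl A) (\<lambda>a. mul A a x)"
    by (rule linear_bilinear_left[OF bilinear_mul])
  from linear_comp[OF snoc this] show ?case
    by simp
qed

lemma linear_foldl_list: "Vector_Spaces.linear (scl A) (scl A) (\<lambda>a. foldl (mul A) b (xs @ a # ys))"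
proof -
  have "Vector_Spaces.linear (scl A) (scl A) (\<lambda>a. mul A (foldl (mul A) b xs) a)"
    by (rule linear_bilinear_right[OF bilinear_mul])
  from linear_comp[OF this linear_foldl_start] show ?thesis
    by simp
qed

end

section \<open>Merging neighbours\<close>

lemma list_split_nth: "i < length l \<Longrightarrow> \<exists>p x q. l = p @ x # q \<and> length p = i"
  by (metis id_take_nth_drop length_take min.absorb4)

lemma list_split_nth2: "Suc i < length l \<Longrightarrow> \<exists>p x y q. l = p @ x # y # q \<and> length p = i"
proof -
  assume "Suc i < length l"
  then obtain p x q where l: "l = p @ x # q" "length p = i"
    using list_split_nth Suc_lessD by metis
  with \<open>Suc i < length l\<close> obtain y q' where "q = y # q'"
    by (cases q) auto
  with l show ?thesis
    by blast
qed

lemma merge_append: "length p = i \<Longrightarrow> merge m (Suc i) (p @ x # y # q) = p @ m x y # q"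
  by (auto simp: merge_def nth_append)

text \<open>A merge either leaves the entry \<open>u\<close> alone, possibly shifting it, or
  multiplies it by a neighbour; so \<open>h\<close> is the identity or a one-sided
  multiplication.\<close>

lemma merge_insert_linear:
  assumes m: "bilinear_map s s s m" and n: "length l1 + length l2 = n" and i: "i \<in> {1..n}"
  obtains k1 h k2 where "Suc (length k1 + length k2) = n" "Vector_Spaces.linear s s h"
    "\<And>u. merge m i (l1 @ u # l2) = k1 @ h u # k2"
proof -
  obtain j where j: "i = Suc j" "j < n"
    using i by (cases i) auto
  have id: "Vector_Spaces.linear s s (\<lambda>u. u)"
    using m by (simp add: bilinear_map_def linear_iff)
  \<comment> \<open>The merged entries have zero-based positions \<open>j\<close> and
    \<open>Suc j\<close>: the slot lies left of both, is the first, is the second, or lies right of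
    both.\<close>
  consider "length l1 < j" | "length l1 = j" | "length l1 = Suc j" | "length l1 > Suc j"
    by linarith
  then show thesis
  proof cases
    case 1
    then have "Suc (j - Suc (length l1)) < length l2"
      using n j by simp
    then obtain p x y q where l2: "l2 = p @ x # y # q" "length p = j - Suc (length l1)"
      using list_split_nth2 by metis
    have "merge m i (l1 @ u # l2) = l1 @ u # p @ m x y # q" for u
      using merge_append[of "l1 @ u # p" j m x y q] 1 l2 j by simp
    then show thesis
      using that[OF _ id, of l1 "p @ m x y # q"] n l2 by simp
  next
    case 2
    then obtain y q where l2: "l2 = y # q"
      using n j by (cases l2) auto
    then show thesis
      using that[OF _ linear_bilinear_left[OF m], of l1 q y] n j 2 merge_append[of l1 j] by simp
  next
    case 3
    then obtain p x where l1: "l1 = p @ [x]"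
      by (cases l1 rule: rev_cases) auto
    then show thesis
      using that[OF _ linear_bilinear_right[OF m], of p l2 x] n j 3 merge_append[of p j] by simp
  next
    case 4
    then obtain p x y q where l1: "l1 = p @ x # y # q" "length p = j"
      using list_split_nth2 by metis
    then show thesis
      using that[OF _ id, of "p @ m x y # q" l2] n j merge_append[of p j] by simp
  qed
qed

text \<open>\<open>Psi\<close> is characterised among multilinear maps, so the Hochschild coboundary
  must be shown to be one before it can be identified with a value of \<open>Psi\<close>.\<close>

lemma hoch_diff_multilinear:
  fixes R :: "('k::field, 'r::ab_group_add) alg" and M :: "('k, 'r, 'm::ab_group_add) bimod"
  assumes g: "g \<in> multilinear_maps n (scl R) (mscl M)" and n: "n \<ge> 1"
    and mul: "bilinear_map (scl R) (scl R) (scl R) (mul R)"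
    and lact: "bilinear_map (scl R) (mscl M) (mscl M) (lact M)"
    and ract: "bilinear_map (mscl M) (scl R) (mscl M) (ract M)"
  shows "hoch_diff R M n g \<in> multilinear_maps (n + 1) (scl R) (mscl M)"
  unfolding multilinear_maps_iff
proof (intro conjI allI impI)
  fix l1 l2 :: "'r list"
  assume len: "Suc (length l1 + length l2) = n + 1"
  have vs: "vector_space (scl R)" "vector_space (mscl M)"
    using lact by (auto simp: bilinear_map_def linear_iff)
  have g_lin: "Vector_Spaces.linear (scl R) (mscl M) (\<lambda>u. g (k1 @ u # k2))"
    if "Suc (length k1 + length k2) = n" for k1 k2
    using g that by (simp add: multilinear_maps_iff)
  have first: "Vector_Spaces.linear (scl R) (mscl M) (\<lambda>u. lact M (hd (l1 @ u # l2)) (g (tl (l1 @ u # l2))))"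
  proof (cases l1)
    case Nil
    then show ?thesis
      using linear_bilinear_left[OF lact] by simp
  next
    case (Cons x k1)
    then show ?thesis
      using linear_comp[OF g_lin[of k1 l2] linear_bilinear_right[OF lact, of x]] len by simp
  qed
  have last: "Vector_Spaces.linear (scl R) (mscl M)
      (\<lambda>u. ract M (g (butlast (l1 @ u # l2))) (last (l1 @ u # l2)))"
  proof (cases l2 rule: rev_cases)
    case Nil
    then show ?thesis
      using linear_bilinear_right[OF ract] by simp
  next
    case (snoc k2 x)
    then show ?thesis
      using linear_comp[OF g_lin[of l1 k2] linear_bilinear_left[OF ract, of x]] len
      by (simp add: butlast_append)
  qed
  have middle: "Vector_Spaces.linear (scl R) (mscl M) (\<lambda>u. g (merge (mul R) i (l1 @ u # l2)))"
    if i: "i \<in> {1..n}" for i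
  proof -
    have len': "length l1 + length l2 = n"
      using len by simp
    obtain k1 h k2 where k: "Suc (length k1 + length k2) = n" "Vector_Spaces.linear (scl R) (scl R) h"
      and "\<And>u. merge (mul R) i (l1 @ u # l2) = k1 @ h u # k2"
      using merge_insert_linear[OF mul len' i] by metis
    then show ?thesis
      using linear_comp[OF k(2) g_lin[OF k(1)]] by simp
  qed
  have "Vector_Spaces.linear (scl R) (mscl M) (\<lambda>u. lact M (hd (l1 @ u # l2)) (g (tl (l1 @ u # l2)))
      + (\<Sum>i=1..n. mscl M ((-1)^i) (g (merge (mul R) i (l1 @ u # l2))))
      + mscl M ((-1)^(n+1)) (ract M (g (butlast (l1 @ u # l2))) (last (l1 @ u # l2))))"
    by (intro linear_add_fun linear_sum_funs linear_scale_fun first middle last vs)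
  moreover have "length (l1 @ u # l2) = n + 1" for u
    using len by simp
  ultimately show "Vector_Spaces.linear (scl R) (mscl M) (\<lambda>u. hoch_diff R M n g (l1 @ u # l2))"
    by (simp only: hoch_diff_def not_not if_False simp_thms)
qed (simp add: hoch_diff_def)

text \<open>The reindexing behind a merge at \<open>i\<close>: position \<open>i\<close> of the
  merged list accounts for positions \<open>i\<close> and \<open>i + 1\<close> of the original, and
  later positions shift by one.\<close>

lemma sum_split_at:
  fixes h :: "nat \<Rightarrow> 'm::comm_monoid_add"
  assumes "i \<in> {1..n}"
  shows "(\<Sum>r=1..n+1. h r) =
    (\<Sum>s=1..n. if s < i then h s else if s = i then h i + h (i + 1) else h (s + 1))"
proof -
  have "i \<le> n" using assms by simp
  then show ?thesis
  proof (induction n rule: dec_induct)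
    case base
    obtain j where "i = Suc j"
      using assms by (cases i) auto
    then show ?case
      by (simp add: add.assoc)
  qed simp
qed

section \<open>Effect of merging and of outer factors on \<open>perm_product\<close>\<close>

context perm_algebra
begin

lemma linear_perm_product:
  assumes "r \<in> {1..Suc (length l1 + length l2)}"
  shows "Vector_Spaces.linear (scl A) (scl A) (\<lambda>a. perm_product A r (l1 @ a # l2))"
proof -
  obtain j where r: "r = Suc j" "j \<le> length l1 + length l2"
    using assms by (cases r) auto
  \<comment> \<open>The leading factor lies right of the slot, is the slot itself, or lies left of
    it.\<close>
  consider "length l1 < j" | "length l1 = j" | "j < length l1"
    by linarith
  then show ?thesis
  proof cases
    case 1
    then have "j - Suc (length l1) < length l2"
      using r by simp
    then obtain p c q where l2: "l2 = p @ c # q" "length p = j - Suc (length l1)"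
      using list_split_nth by metis
    then have "perm_product A r (l1 @ a # l2) = foldl (mul A) c (rev p @ a # rev l1 @ q)" for a
      using perm_product_append[of "l1 @ a # p" j c q] 1 r by simp
    then show ?thesis
      by (simp only: linear_foldl_list)
  next
    case 2
    then show ?thesis
      unfolding r(1) by (simp only: perm_product_append linear_foldl_start)
  next
    case 3
    then obtain p c q where l1: "l1 = p @ c # q" "length p = j"
      using list_split_nth by metis
    then have "perm_product A r (l1 @ a # l2) = foldl (mul A) c ((rev p @ q) @ a # l2)" for a
      using perm_product_append[of p j c "q @ a # l2"] r by simp
    then show ?thesis
      by (simp only: linear_foldl_list)
  qed
qed

text \<open>Here the merged entry is not the leading factor, and in a later position xy and yx act
  alike. If the leading factor comes after the merge, its index grows by one in the unmerged
  list.\<close>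

lemma perm_product_merge:
  assumes "length p = j" "z = mul A x y \<or> z = mul A y x" "s \<in> {1..Suc (j + length q)}"
  shows "s < Suc j \<Longrightarrow> perm_product A s (p @ z # q) = perm_product A s (p @ x # y # q)"
    and "Suc j < s \<Longrightarrow> perm_product A s (p @ z # q) = perm_product A (Suc s) (p @ x # y # q)"
proof -
  obtain k where k: "s = Suc k"
    using assms(3) by (cases s) auto
  {
    assume "s < Suc j"
    then obtain p1 c p2 where p: "p = p1 @ c # p2" "length p1 = k"
      using list_split_nth[of k p] k assms(1) by auto
    let ?l = "rev p1 @ p2"
    have "perm_product A s (p @ z # q) = foldl (mul A) c (?l @ z # q)"
      using p k by (simp add: perm_product_append)
    also have "\<dots> = foldl (mul A) c (?l @ x # y # q)"
      using assms(2) by (auto simp: mul_assoc[symmetric] mul_right_commute[of _ y x])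
    also have "\<dots> = perm_product A s (p @ x # y # q)"
      using p k by (simp add: perm_product_append)
    finally show "perm_product A s (p @ z # q) = perm_product A s (p @ x # y # q)" .
  next
    assume "Suc j < s"
    then have "k - Suc j < length q"
      using assms(3) k by simp
    then obtain q1 c q2 where q: "q = q1 @ c # q2" "length q1 = k - Suc j"
      using list_split_nth by metis
    have "perm_product A s (p @ z # q) = foldl (mul A) c (rev q1 @ z # rev p @ q2)"
      using q k \<open>Suc j < s\<close> assms(1) perm_product_append[of "p @ z # q1" k c q2] by simp
    also have "\<dots> = foldl (mul A) c (rev q1 @ y # x # rev p @ q2)"
      using assms(2) by (auto simp: mul_assoc[symmetric] mul_right_commute[of _ y x])
    also have "\<dots> = perm_product A (Suc s) (p @ x # y # q)"
      using q k \<open>Suc j < s\<close> assms(1) perm_product_append[of "p @ x # y # q1" "Suc k" c q2] by simp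
    finally show "perm_product A s (p @ z # q) = perm_product A (Suc s) (p @ x # y # q)" .
  }
qed

text \<open>When the merged entry leads, the order of its factors decides which of the two
  neighbours leads in the unmerged list. This is what keeps the \<prec> and \<succ> terms
  apart.\<close>

lemma perm_product_merge_at:
  assumes "length p = j"
  shows "perm_product A (Suc j) (p @ mul A x y # q) = perm_product A (Suc j) (p @ x # y # q)"
    and "perm_product A (Suc j) (p @ mul A y x # q) = perm_product A (Suc (Suc j)) (p @ x # y # q)"
proof -
  have fold1: "foldl (mul A) (mul A a b) l = foldl (mul A) a (b # l)" for a b l
    by simp
  show "perm_product A (Suc j) (p @ mul A x y # q) = perm_product A (Suc j) (p @ x # y # q)"
    unfolding perm_product_append[OF assms] fold1 by (rule foldl_mul_mset_cong) simp
  show "perm_product A (Suc j) (p @ mul A y x # q) = perm_product A (Suc (Suc j)) (p @ x # y # q)"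
    using assms perm_product_append[of "p @ [x]" "Suc j" y q] by (simp add: perm_product_append)
qed

text \<open>Index bookkeeping for the left action: its \<prec> terms all land in component 1, its
  \<succ> terms move from \<open>i\<close> to \<open>Suc i\<close>.\<close>

lemma mul_perm_product_left:
  assumes "i \<in> {1..length as}"
  shows "mul A a (perm_product A i as) = perm_product A 1 (a # as)"
    and "mul A (perm_product A i as) a = perm_product A (Suc i) (a # as)"
proof -
  obtain j where i: "i = Suc j" "j < length as"
    using assms by (cases i) auto
  then obtain p c q where as: "as = p @ c # q" "length p = j"
    using list_split_nth by metis
  show "mul A a (perm_product A i as) = perm_product A 1 (a # as)"
  proof -
    have "mul A a (perm_product A i as) = foldl (mul A) a (c # rev p @ q)"
      unfolding i as(1) perm_product_append[OF as(2)] mul_foldl ..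
    also have "\<dots> = foldl (mul A) a as"
      by (rule foldl_mul_mset_cong) (simp add: as)
    finally show ?thesis
      using perm_product_append[of "[]" 0 a as] by simp
  qed
  have "mul A (perm_product A i as) a = foldl (mul A) c ((rev p @ q) @ [a])"
    using i as by (simp add: perm_product_append)
  also have "\<dots> = foldl (mul A) c (rev (a # p) @ q)"
    by (rule foldl_mul_mset_cong) simp
  also have "\<dots> = perm_product A (Suc i) (a # as)"
    using i as perm_product_append[of "a # p" "Suc j" c q] by simp
  finally show "mul A (perm_product A i as) a = perm_product A (Suc i) (a # as)" .
qed

text \<open>For the right action, \<prec> terms keep their component and all \<succ> terms land in
  the last one.\<close>

lemma mul_perm_product_right:
  assumes "i \<in> {1..length as}"
  shows "mul A (perm_product A i as) a = perm_product A i (as @ [a])"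
    and "mul A a (perm_product A i as) = perm_product A (Suc (length as)) (as @ [a])"
proof -
  obtain j where i: "i = Suc j" "j < length as"
    using assms by (cases i) auto
  then obtain p c q where as: "as = p @ c # q" "length p = j"
    using list_split_nth by metis
  show "mul A (perm_product A i as) a = perm_product A i (as @ [a])"
    using i as by (simp add: perm_product_append)
  show "mul A a (perm_product A i as) = perm_product A (Suc (length as)) (as @ [a])"
    unfolding perm_product_append[OF refl] i as(1) perm_product_append[OF as(2)] mul_foldl
    by (rule foldl_mul_mset_cong) simp
qed

end

section \<open>The cochain map\<close>

lemma dend_cochainsD:
  assumes "f \<in> dend_cochains B N n"
  shows "r \<in> {1..n} \<Longrightarrow> Suc (length l1 + length l2) = n \<Longrightarrow>
      Vector_Spaces.linear (dscl B) (nscl N) (\<lambda>b. f r (l1 @ b # l2))"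
    and "length bs \<noteq> n \<Longrightarrow> f r bs = 0" and "r \<notin> {1..n} \<Longrightarrow> f r bs = 0"
proof -
  have ml: "f r \<in> multilinear_maps n (dscl B) (nscl N)" if "r \<in> {1..n}" for r
    using assms that by (simp add: dend_cochains_def)
  show zero: "f r bs = 0" if "r \<notin> {1..n}" for r bs
    using assms that by (simp add: dend_cochains_def)
  show "Vector_Spaces.linear (dscl B) (nscl N) (\<lambda>b. f r (l1 @ b # l2))"
    if "r \<in> {1..n}" "Suc (length l1 + length l2) = n"
    using ml that by (simp add: multilinear_maps_iff)
  show "f r bs = 0" if "length bs \<noteq> n"
    using ml[of r] zero[of r] that by (cases "r \<in> {1..n}") (simp_all add: multilinear_maps_def)
qed

lemma sum_split_first:
  fixes h :: "nat \<Rightarrow> 'm::comm_monoid_add"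
  shows "(\<Sum>r=1..n+1. h r) = h 1 + (\<Sum>i=1..n. h (Suc i))"
  by (induction n) (simp_all add: add.assoc)

text \<open>The contribution of \<open>merge i\<close> to the \<open>r\<close>-th component of the differential; the three
  cases of the definition of the differential then become a single formula.\<close>

definition dend_inner ::
  "('k, 'b::ab_group_add) dend \<Rightarrow> (nat \<Rightarrow> 'b list \<Rightarrow> 'n) \<Rightarrow> nat \<Rightarrow> nat \<Rightarrow> 'b list \<Rightarrow> 'n" where
  "dend_inner B f i r bs =
     (if r < i then f r (merge (dstar B) i bs)
      else if r = i then f r (merge (dprec B) i bs)
      else if r = i + 1 then f (r - 1) (merge (dsucc B) i bs)
      else f (r - 1) (merge (dstar B) i bs))"

text \<open>In the middle sum, \<open>i = r - 1\<close> yields the \<succ> term and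
  \<open>i = r\<close> the \<prec> term. For \<open>r = 1\<close> the former and for
  \<open>r = n + 1\<close> the latter falls outside the range, as in the definition.\<close>

lemma dend_diff_eq:
  assumes vs: "vector_space (nscl N)" and "n \<ge> 1" and len: "length bs = n + 1" and r: "r \<in> {1..n+1}"
  shows "dend_diff B N n f r bs =
    (if r = 1 then \<Sum>i=1..n. lprec N (hd bs) (f i (tl bs)) else lsucc N (hd bs) (f (r - 1) (tl bs)))
    + (\<Sum>i=1..n. nscl N ((-1)^i) (dend_inner B f i r bs))
    + nscl N ((-1)^(n+1))
        (if r = n + 1 then \<Sum>i=1..n. rsucc N (f i (butlast bs)) (last bs)
         else rprec N (f r (butlast bs)) (last bs))"
proof -
  interpret vector_space "nscl N" by fact
  let ?h = "\<lambda>i. nscl N ((-1)^i) (dend_inner B f i r bs)"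
  consider "r = 1" | "2 \<le> r" "r \<le> n" | "r = n + 1" "r \<noteq> 1"
    using r by fastforce
  then show ?thesis
  proof cases
    case 1
    have "(\<Sum>i=1..n. ?h i) = ?h 1 + (\<Sum>i=2..n. ?h i)"
      using \<open>n \<ge> 1\<close> by (simp add: sum.atLeast_Suc_atMost numeral_2_eq_2)
    also have "(\<Sum>i=2..n. ?h i) = (\<Sum>i=2..n. nscl N ((-1)^i) (f 1 (merge (dstar B) i bs)))"
      using 1 by (intro sum.cong) (auto simp: dend_inner_def)
    finally show ?thesis
      using 1 len \<open>n \<ge> 1\<close> by (simp add: dend_diff_def dend_inner_def)
  next
    case 2
    \<comment> \<open>This form lets the truncated subtractions \<open>r - 1\<close> and
      \<open>r - 2\<close> simplify.\<close>
    obtain j where j: "r = Suc (Suc j)"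
      using 2 by (metis add_2_eq_Suc le_Suc_ex)
    have "{1..n} = {1..r-2} \<union> {r-1, r} \<union> {r+1..n}"
      using 2 by auto
    then have "(\<Sum>i=1..n. ?h i) = (\<Sum>i=1..r-2. ?h i) + (?h (r - 1) + ?h r) + (\<Sum>i=r+1..n. ?h i)"
      using j by (simp add: sum.union_disjoint)
    also have "(\<Sum>i=1..r-2. ?h i) = (\<Sum>i=1..r-2. nscl N ((-1)^i) (f (r - 1) (merge (dstar B) i bs)))"
      using 2 by (intro sum.cong) (auto simp: dend_inner_def)
    also have "(\<Sum>i=r+1..n. ?h i) = (\<Sum>i=r+1..n. nscl N ((-1)^i) (f r (merge (dstar B) i bs)))"
      by (intro sum.cong) (auto simp: dend_inner_def)
    finally show ?thesis
      using 2 len r j by (simp add: dend_diff_def dend_inner_def algebra_simps)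
  next
    case 3
    have "(\<Sum>i=1..n. ?h i) = (\<Sum>i=1..n-1. ?h i) + ?h n"
      using \<open>n \<ge> 1\<close> by (cases n) simp_all
    also have "(\<Sum>i=1..n-1. ?h i) = (\<Sum>i=1..n-1. nscl N ((-1)^i) (f n (merge (dstar B) i bs)))"
      using 3 by (intro sum.cong) (auto simp: dend_inner_def)
    finally show ?thesis
      using 3 len r by (simp add: dend_diff_def dend_inner_def)
  qed
qed

text \<open>The locale asks for the Perm laws on \<open>A\<close>; freeness enters through the
  functionals supplied to \<open>Psi_inj_on\<close>.\<close>

locale tensor_cochains =
  perm_algebra A + AB: tensor_product "scl A" "dscl B" sR tB + AN: tensor_product "scl A" "nscl N" sM tN
  for A :: "('k::field, 'a::ab_group_add) alg"
    and B :: "('k, 'b::ab_group_add) dend"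
    and N :: "('k, 'b, 'n::ab_group_add) dend_rep"
    and sR :: "'k \<Rightarrow> 'r::ab_group_add \<Rightarrow> 'r" and tB :: "'a \<Rightarrow> 'b \<Rightarrow> 'r"
    and sM :: "'k \<Rightarrow> 'm::ab_group_add \<Rightarrow> 'm" and tN :: "'a \<Rightarrow> 'n \<Rightarrow> 'm" +
  assumes dend: "dendriform B" and rep: "dend_representation B N"
begin

abbreviation "R \<equiv> tensor_alg A B sR tB"
abbreviation "M \<equiv> tensor_bimod A B N sR tB sM tN"

lemma scl_R [simp]: "scl R = sR" and mscl_M [simp]: "mscl M = sM"
  by (simp_all add: tensor_alg_def tensor_bimod_def)

lemma bilinear_ops:
  "bilinear_map (dscl B) (dscl B) (dscl B) (dprec B)" "bilinear_map (dscl B) (dscl B) (dscl B) (dsucc B)"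
  "bilinear_map (dscl B) (nscl N) (nscl N) (lprec N)" "bilinear_map (dscl B) (nscl N) (nscl N) (lsucc N)"
  "bilinear_map (nscl N) (dscl B) (nscl N) (rprec N)" "bilinear_map (nscl N) (dscl B) (nscl N) (rsucc N)"
  using dend rep by (auto simp: dendriform_def dend_representation_def)

lemmas linear_tN = linear_bilinear_left[OF AN.bilinear_tensor] linear_bilinear_right[OF AN.bilinear_tensor]

text \<open>The required values are bilinear in either pair of variables, so
  \<open>bilinear_tensor_lift_ex1\<close> discharges the \<open>THE\<close>. The two actions are
  handled in the same way.\<close>

lemma mul_R:
  "bilinear_map sR sR sR (mul R)"
  "mul R (tB a1 b1) (tB a2 b2) = tB (mul A a1 a2) (dprec B b1 b2) + tB (mul A a2 a1) (dsucc B b1 b2)"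
proof -
  have "\<exists>!m. bilinear_map sR sR sR m \<and> (\<forall>a1 b1 a2 b2. m (tB a1 b1) (tB a2 b2) =
      tB (mul A a1 a2) (dprec B b1 b2) + tB (mul A a2 a1) (dsucc B b1 b2))"
    by (rule AB.bilinear_tensor_lift_ex1[OF AB.tensor_product_axioms];
        intro bilinear_map_add_fun bilinear_map_comp[OF AB.bilinear_tensor]
          linear_bilinear_left[OF bilinear_mul] linear_bilinear_right[OF bilinear_mul]
          linear_bilinear_left[OF bilinear_ops(1)] linear_bilinear_right[OF bilinear_ops(1)]
          linear_bilinear_left[OF bilinear_ops(2)] linear_bilinear_right[OF bilinear_ops(2)])
  from theI'[OF this] show "bilinear_map sR sR sR (mul R)"
    "mul R (tB a1 b1) (tB a2 b2) = tB (mul A a1 a2) (dprec B b1 b2) + tB (mul A a2 a1) (dsucc B b1 b2)"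
    by (simp_all add: tensor_alg_def)
qed

lemma lact_M:
  "bilinear_map sR sM sM (lact M)"
  "lact M (tB a' b) (tN a n) = tN (mul A a' a) (lprec N b n) + tN (mul A a a') (lsucc N b n)"
proof -
  have "\<exists>!l. bilinear_map sR sM sM l \<and> (\<forall>a' b a n. l (tB a' b) (tN a n) =
      tN (mul A a' a) (lprec N b n) + tN (mul A a a') (lsucc N b n))"
    by (rule AB.bilinear_tensor_lift_ex1[OF AN.tensor_product_axioms];
        intro bilinear_map_add_fun bilinear_map_comp[OF AN.bilinear_tensor]
          linear_bilinear_left[OF bilinear_mul] linear_bilinear_right[OF bilinear_mul]
          linear_bilinear_left[OF bilinear_ops(3)] linear_bilinear_right[OF bilinear_ops(3)]
          linear_bilinear_left[OF bilinear_ops(4)] linear_bilinear_right[OF bilinear_ops(4)])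
  from theI'[OF this] show "bilinear_map sR sM sM (lact M)"
    "lact M (tB a' b) (tN a n) = tN (mul A a' a) (lprec N b n) + tN (mul A a a') (lsucc N b n)"
    by (simp_all add: tensor_bimod_def)
qed

lemma ract_M:
  "bilinear_map sM sR sM (ract M)"
  "ract M (tN a n) (tB a' b) = tN (mul A a a') (rprec N n b) + tN (mul A a' a) (rsucc N n b)"
proof -
  have "\<exists>!l. bilinear_map sM sR sM l \<and> (\<forall>a n a' b. l (tN a n) (tB a' b) =
      tN (mul A a a') (rprec N n b) + tN (mul A a' a) (rsucc N n b))"
    by (rule AN.bilinear_tensor_lift_ex1[OF AB.tensor_product_axioms];
        intro bilinear_map_add_fun bilinear_map_comp[OF AN.bilinear_tensor]
          linear_bilinear_left[OF bilinear_mul] linear_bilinear_right[OF bilinear_mul]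
          linear_bilinear_left[OF bilinear_ops(5)] linear_bilinear_right[OF bilinear_ops(5)]
          linear_bilinear_left[OF bilinear_ops(6)] linear_bilinear_right[OF bilinear_ops(6)])
  from theI'[OF this] show "bilinear_map sM sR sM (ract M)"
    "ract M (tN a n) (tB a' b) = tN (mul A a a') (rprec N n b) + tN (mul A a' a) (rsucc N n b)"
    by (simp_all add: tensor_bimod_def)
qed

section \<open>Existence and uniqueness of \<open>Psi\<close>\<close>

lemma Psi_formula_iff:
  "Psi_formula A tB tN n f g \<longleftrightarrow>
     (\<forall>ps. length ps = n \<longrightarrow> g (map (\<lambda>(a, b). tB a b) ps) =
        (\<Sum>r=1..n. tN (perm_product A r (map fst ps)) (f r (map snd ps))))"
  (is "_ \<longleftrightarrow> ?R")
proof
  assume "Psi_formula A tB tN n f g"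
  then show ?R
    unfolding Psi_formula_def by (metis length_map zip_map_fst_snd)
next
  assume ?R
  show "Psi_formula A tB tN n f g"
    unfolding Psi_formula_def
  proof (intro allI impI)
    fix as :: "'a list" and bs :: "'b list"
    assume "length as = n" "length bs = n"
    then show "g (map2 tB as bs) = (\<Sum>r=1..n. tN (perm_product A r as) (f r bs))"
      using \<open>?R\<close>[rule_format, of "zip as bs"] by simp
  qed
qed

text \<open>A multilinear map is determined by its values on pure tensors. The later identities for
  \<open>Psi\<close> are all obtained by exhibiting a candidate here.\<close>

lemma Psi_eqI:
  assumes "g \<in> multilinear_maps n sR sM" "Psi_formula A tB tN n f g"
  shows "Psi A sR tB sM tN n f = g"
  unfolding Psi_def
proof (rule the_equality)
  show "h = g" if "h \<in> multilinear_maps n sR sM \<and> Psi_formula A tB tN n f h" for h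
    using that assms by (intro AB.multilinear_eq_on_tensors) (auto simp: Psi_formula_iff)
qed (use assms in simp)

lemma Psi_properties:
  assumes f: "f \<in> dend_cochains B N n"
  shows "Psi A sR tB sM tN n f \<in> multilinear_maps n sR sM"
    and "Psi_formula A tB tN n f (Psi A sR tB sM tN n f)"
proof -
  \<comment> \<open>The defining formula on lists of pairs, cut off to \<open>0\<close> at other
    lengths as \<open>multibilinear_maps\<close> demands.\<close>
  let ?F = "\<lambda>ps. if length ps = n then
      \<Sum>r=1..n. tN (perm_product A r (map fst ps)) (f r (map snd ps)) else 0"
  have "bilinear_map (scl A) (dscl B) sM (\<lambda>a b. ?F (l1 @ (a, b) # l2))"
    if len: "Suc (length l1 + length l2) = n" for l1 l2
  proof -
    have "bilinear_map (scl A) (dscl B) sM (\<lambda>a b. \<Sum>r=1..n.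
        tN (perm_product A r (map fst l1 @ a # map fst l2)) (f r (map snd l1 @ b # map snd l2)))"
      using len by (intro bilinear_map_sum_funs bilinear_map_comp[OF AN.bilinear_tensor]
          linear_perm_product dend_cochainsD(1)[OF f] AB.tensor_product_vector_spaces
          AN.tensor_product_vector_spaces) simp_all
    then show ?thesis
      using len by simp
  qed
  then have "?F \<in> multibilinear_maps n (scl A) (dscl B) sM"
    by (simp add: multibilinear_maps_def)
  from AB.multilinear_extension_exists[OF AN.tensor_product_vector_spaces(3) this]
  obtain g where g: "g \<in> multilinear_maps n sR sM" "Psi_formula A tB tN n f g"
    by (auto simp: Psi_formula_iff)
  then show "Psi A sR tB sM tN n f \<in> multilinear_maps n sR sM"
    "Psi_formula A tB tN n f (Psi A sR tB sM tN n f)"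
    using Psi_eqI[OF g] by simp_all
qed

text \<open>Multiplying two neighbours gives a \<prec> part and a \<succ> part. For
  \<open>s \<noteq> i\<close> their Perm products agree and the parts add up to
  \<open>dstar\<close>; for \<open>s = i\<close> they belong to the components \<open>i\<close> and
  \<open>i + 1\<close>.\<close>

lemma Psi_merge:
  assumes f: "f \<in> dend_cochains B N n" and i: "i \<in> {1..n}"
    and len: "length as = n + 1" "length bs = n + 1"
    and g: "g \<in> multilinear_maps n sR sM" "Psi_formula A tB tN n f g"
  shows "g (merge (mul R) i (map2 tB as bs)) =
    (\<Sum>r=1..n+1. tN (perm_product A r as) (dend_inner B f i r bs))"
proof -
  obtain j where j: "i = Suc j" "j < n"
    using i by (cases i) auto
  obtain p x y q where as: "as = p @ x # y # q" "length p = j"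
    using list_split_nth2[of j as] j len by auto
  obtain p' x' y' q' where bs: "bs = p' @ x' # y' # q'" "length p' = j"
    using list_split_nth2[of j bs] j len by auto
  have lens: "Suc (j + length q) = n" "Suc (j + length q') = n"
    using as bs len by auto
  let ?b1 = "dprec B x' y'" and ?b2 = "dsucc B x' y'"
  let ?P = "map2 tB p p'" and ?Q = "map2 tB q q'"
  have m: "merge (mul R) i (map2 tB as bs) =
      ?P @ (tB (mul A x y) ?b1 + tB (mul A y x) ?b2) # ?Q"
    using as bs j merge_append[of ?P j "mul R" "tB x x'" "tB y y'" ?Q] by (simp add: mul_R(2))
  have g_lin: "Vector_Spaces.linear sR sM (\<lambda>u. g (?P @ u # ?Q))"
    using g(1) as bs lens by (simp add: multilinear_maps_iff)
  have g_tensor: "g (?P @ tB a b # ?Q) =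
      (\<Sum>s=1..n. tN (perm_product A s (p @ a # q)) (f s (p' @ b # q')))" for a b
    using g(2)[unfolded Psi_formula_def, rule_format, of "p @ a # q" "p' @ b # q'"] as bs lens
    by simp
  have "g (merge (mul R) i (map2 tB as bs)) =
      (\<Sum>s=1..n. tN (perm_product A s (p @ mul A x y # q)) (f s (p' @ ?b1 # q')) +
         tN (perm_product A s (p @ mul A y x # q)) (f s (p' @ ?b2 # q')))"
    by (simp only: m linear_simps(1)[OF g_lin] g_tensor sum.distrib)
  also have "\<dots> = (\<Sum>s=1..n. if s < i then tN (perm_product A s as) (dend_inner B f i s bs)
      else if s = i then tN (perm_product A i as) (dend_inner B f i i bs) +
         tN (perm_product A (i + 1) as) (dend_inner B f i (i + 1) bs)
      else tN (perm_product A (s + 1) as) (dend_inner B f i (s + 1) bs))"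
  proof (rule sum.cong[OF refl])
    fix s assume s: "s \<in> {1..n}"
    then have s': "s \<in> {1..Suc (j + length q)}"
      using lens by simp
    have mb: "merge m i bs = p' @ m x' y' # q'" for m
      using bs j merge_append[of p' j] by simp
    have f_add: "f s (p' @ dstar B x' y' # q') = f s (p' @ ?b1 # q') + f s (p' @ ?b2 # q')"
      using linear_simps(1)[OF dend_cochainsD(1)[OF f s]] bs lens by (simp add: dstar_def)
    note tN_add = linear_simps(1)[OF linear_tN(2)]
    consider "s < i" | "s = i" | "i < s" by linarith
    then show "tN (perm_product A s (p @ mul A x y # q)) (f s (p' @ ?b1 # q')) +
         tN (perm_product A s (p @ mul A y x # q)) (f s (p' @ ?b2 # q')) =
      (if s < i then tN (perm_product A s as) (dend_inner B f i s bs)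
      else if s = i then tN (perm_product A i as) (dend_inner B f i i bs) +
         tN (perm_product A (i + 1) as) (dend_inner B f i (i + 1) bs)
      else tN (perm_product A (s + 1) as) (dend_inner B f i (s + 1) bs))"
    proof cases
      case 1
      then have "s < Suc j" using j by simp
      with 1 show ?thesis
        using perm_product_merge(1)[OF as(2) _ s', of _ x y] as(1)
        by (simp add: dend_inner_def mb f_add tN_add)
    next
      case 2
      then show ?thesis
        using perm_product_merge_at[OF as(2), where x = x and y = y and q = q] as(1) j
        by (simp add: dend_inner_def mb[unfolded j(1)])
    next
      case 3
      then have "Suc j < s" using j by simp
      with 3 show ?thesis
        using perm_product_merge(2)[OF as(2) _ s', of _ x y] as(1)
        by (simp add: dend_inner_def mb f_add tN_add)
    qed
  qed
  also have "\<dots> = (\<Sum>r=1..n+1. tN (perm_product A r as) (dend_inner B f i r bs))"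
    by (rule sum_split_at[OF i, symmetric])
  finally show ?thesis .
qed

text \<open>By \<open>Psi_eqI\<close> pure tensors suffice. Left action, merges and right action are
  each sorted by the leading factor \<open>r\<close>, and the coefficients are matched with
  \<open>dend_diff_eq\<close>.\<close>

lemma Psi_cochain_map:
  assumes f: "f \<in> dend_cochains B N n" and n: "n \<ge> 1"
  shows "Psi A sR tB sM tN (n + 1) (dend_diff B N n f) = hoch_diff R M n (Psi A sR tB sM tN n f)"
proof (rule Psi_eqI)
  let ?g = "Psi A sR tB sM tN n f"
  note g = Psi_properties[OF f]
  show "hoch_diff R M n ?g \<in> multilinear_maps (n + 1) sR sM"
    using hoch_diff_multilinear[of ?g n R M] g n mul_R(1) lact_M(1) ract_M(1) by simp
  show "Psi_formula A tB tN (n + 1) (dend_diff B N n f) (hoch_diff R M n ?g)"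
    unfolding Psi_formula_def
  proof (intro allI impI)
    fix as :: "'a list" and bs :: "'b list"
    assume len: "length as = n + 1" "length bs = n + 1"
    let ?P = "\<lambda>r. perm_product A r as"
    let ?rs = "map2 tB as bs"
    have vs: "vector_space sM" "vector_space (nscl N)"
      using AN.tensor_product_vector_spaces by auto
    interpret M: vector_space sM by fact
    obtain a as1 b bs1 where 1: "as = a # as1" "bs = b # bs1"
      using len by (metis Suc_eq_plus1 length_Suc_conv)
    obtain a' as2 b' bs2 where 2: "as = as2 @ [a']" "bs = bs2 @ [b']"
      using len by (metis Suc_eq_plus1 length_Suc_conv_rev)
    have len1: "length as1 = n" "length bs1 = n" "length as2 = n" "length bs2 = n"
      using len 1 2 by (simp, simp, metis Suc_eq_plus1 length_append_singleton nat.inject,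
          metis Suc_eq_plus1 length_append_singleton nat.inject)
    \<comment> \<open>\<open>U\<close> and \<open>V\<close> are the left and right outer
      contributions to component \<open>r\<close> in \<open>dend_diff_eq\<close>, with the sign of
      \<open>V\<close> left out.\<close>
    define U where "U r = (if r = 1 then \<Sum>i=1..n. lprec N b (f i bs1) else lsucc N b (f (r - 1) bs1))" for r
    define V where "V r = (if r = n + 1 then \<Sum>i=1..n. rsucc N (f i bs2) b' else rprec N (f r bs2) b')" for r
    note lin_sum = linear_sum_fun[OF linear_tN(2)]
    have first: "lact M (hd ?rs) (?g (tl ?rs)) = (\<Sum>r=1..n+1. tN (?P r) (U r))"
    proof -
      have "lact M (hd ?rs) (?g (tl ?rs)) =
          lact M (tB a b) (\<Sum>i=1..n. tN (perm_product A i as1) (f i bs1))"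
        using g(2) len1 by (simp add: 1 Psi_formula_def)
      also have "\<dots> = (\<Sum>i=1..n. tN (mul A a (perm_product A i as1)) (lprec N b (f i bs1))
          + tN (mul A (perm_product A i as1) a) (lsucc N b (f i bs1)))"
        by (simp only: linear_sum_fun[OF linear_bilinear_right[OF lact_M(1)]] lact_M(2))
      also have "\<dots> = (\<Sum>i=1..n. tN (?P 1) (lprec N b (f i bs1)) + tN (?P (Suc i)) (lsucc N b (f i bs1)))"
        using mul_perm_product_left[of _ as1 a] len1 1 by (intro sum.cong) auto
      also have "\<dots> = tN (?P 1) (U 1) + (\<Sum>i=1..n. tN (?P (Suc i)) (U (Suc i)))"
        by (simp add: U_def sum.distrib lin_sum)
      also have "\<dots> = (\<Sum>r=1..n+1. tN (?P r) (U r))"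
        by (rule sum_split_first[symmetric])
      finally show ?thesis .
    qed
    have last: "ract M (?g (butlast ?rs)) (last ?rs) = (\<Sum>r=1..n+1. tN (?P r) (V r))"
    proof -
      have "?rs = map2 tB as2 bs2 @ [tB a' b']"
        using len1 by (simp add: 2)
      then have "ract M (?g (butlast ?rs)) (last ?rs) =
          ract M (\<Sum>i=1..n. tN (perm_product A i as2) (f i bs2)) (tB a' b')"
        using g(2) len1 by (simp add: Psi_formula_def)
      also have "\<dots> = (\<Sum>i=1..n. tN (mul A (perm_product A i as2) a') (rprec N (f i bs2) b')
          + tN (mul A a' (perm_product A i as2)) (rsucc N (f i bs2) b'))"
        by (simp only: linear_sum_fun[OF linear_bilinear_left[OF ract_M(1)]] ract_M(2))
      also have "\<dots> = (\<Sum>i=1..n. tN (?P i) (rprec N (f i bs2) b') + tN (?P (n + 1)) (rsucc N (f i bs2) b'))"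
        using mul_perm_product_right[of _ as2 a'] len1 2 by (intro sum.cong) auto
      also have "\<dots> = (\<Sum>i=1..n. tN (?P i) (V i)) + tN (?P (n + 1)) (V (n + 1))"
        by (simp add: V_def sum.distrib lin_sum)
      finally show ?thesis by simp
    qed
    have "(\<Sum>i=1..n. sM ((-1)^i) (?g (merge (mul R) i ?rs))) =
        (\<Sum>i=1..n. \<Sum>r=1..n+1. tN (?P r) (nscl N ((-1)^i) (dend_inner B f i r bs)))"
      using Psi_merge[OF f _ len g]
      by (intro sum.cong) (simp_all only: M.scale_sum_right linear_simps(2)[OF linear_tN(2)])
    also have "\<dots> = (\<Sum>r=1..n+1. tN (?P r) (\<Sum>i=1..n. nscl N ((-1)^i) (dend_inner B f i r bs)))"
      by (subst sum.swap) (simp only: lin_sum)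
    finally have middle: "(\<Sum>i=1..n. sM ((-1)^i) (?g (merge (mul R) i ?rs))) = \<dots>" .
    have diff: "dend_diff B N n f r bs = U r + (\<Sum>i=1..n. nscl N ((-1)^i) (dend_inner B f i r bs))
        + nscl N ((-1)^(n+1)) (V r)" if "r \<in> {1..n+1}" for r
    proof -
      have "hd bs = b" "tl bs = bs1" "butlast bs = bs2" "last bs = b'"
        using 1(2) 2(2) by (metis list.sel(1), metis list.sel(3), metis butlast_snoc, metis last_snoc)
      then show ?thesis
        using dend_diff_eq[OF vs(2) n len(2) that, of B f] by (simp only: U_def V_def)
    qed
    have "hoch_diff R M n ?g ?rs = (\<Sum>r=1..n+1. tN (?P r) (U r))
        + (\<Sum>r=1..n+1. tN (?P r) (\<Sum>i=1..n. nscl N ((-1)^i) (dend_inner B f i r bs)))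
        + sM ((-1)^(n+1)) (\<Sum>r=1..n+1. tN (?P r) (V r))"
      using len unfolding hoch_diff_def first last mscl_M middle by simp
    also have "\<dots> = (\<Sum>r=1..n+1. tN (?P r) (dend_diff B N n f r bs))"
      unfolding M.scale_sum_right sum.distrib[symmetric]
      by (rule sum.cong[OF refl]) (simp only: diff linear_simps(1,2)[OF linear_tN(2)])
    finally show "hoch_diff R M n ?g ?rs = (\<Sum>r=1..n+1. tN (?P r) (dend_diff B N n f r bs))" .
  qed
qed

section \<open>Linearity and injectivity of \<open>Psi\<close>\<close>

lemma Psi_add:
  assumes "f \<in> dend_cochains B N n" "h \<in> dend_cochains B N n"
  shows "Psi A sR tB sM tN n (\<lambda>r bs. f r bs + h r bs) =
    (\<lambda>ts. Psi A sR tB sM tN n f ts + Psi A sR tB sM tN n h ts)"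
  using Psi_properties[OF assms(1)] Psi_properties[OF assms(2)]
  by (intro Psi_eqI) (auto simp: multilinear_maps_iff Psi_formula_def linear_add_fun sum.distrib
      linear_simps(1)[OF linear_tN(2)])

lemma Psi_scale:
  assumes "f \<in> dend_cochains B N n"
  shows "Psi A sR tB sM tN n (\<lambda>r bs. nscl N c (f r bs)) = (\<lambda>ts. sM c (Psi A sR tB sM tN n f ts))"
proof -
  interpret M: vector_space sM
    by (rule AN.tensor_product_vector_spaces)
  show ?thesis
    using Psi_properties[OF assms]
    by (intro Psi_eqI) (auto simp: multilinear_maps_iff Psi_formula_def M.scale_sum_right
        linear_simps(2)[OF linear_tN(2)] intro: linear_scale_fun)
qed

text \<open>Evaluating at \<open>a\<^sub>r = a\<close> and \<open>a\<^sub>s = b\<close> for \<open>s \<noteq> r\<close>, the functional \<open>\<mu>\<close> only sees the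
  summand of index \<open>r\<close>, since \<open>\<mu>\<close> of a product is determined up to \<open>\<epsilon>\<close> by its first factor.\<close>

lemma Psi_inj_on:
  assumes \<mu>: "Vector_Spaces.linear (scl A) (*) \<mu>" "\<And>c d. \<mu> (mul A c d) = \<mu> c * \<epsilon> d"
    and ab: "\<mu> a = 1" "\<epsilon> a = 1" "\<mu> b = 0" "\<epsilon> b = 1"
  shows "inj_on (Psi A sR tB sM tN n) (dend_cochains B N n)"
proof (rule inj_onI)
  have N: "vector_space (nscl N)"
    by (rule AN.tensor_product_vector_spaces)
  interpret N: vector_space "nscl N" by fact
  \<comment> \<open>The map \<Lambda> obtained from this is \<mu> tensored with the identity, with
    values in \<open>N\<close> itself.\<close>
  have "bilinear_map (scl A) (nscl N) (nscl N) (\<lambda>c v. nscl N (\<mu> c) v)"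
    using linear_simps[OF \<mu>(1)] vector_space N
    by (intro bilinear_mapI) (simp_all add: N.scale_left_distrib N.scale_right_distrib mult.commute)
  then obtain \<Lambda> where \<Lambda>: "Vector_Spaces.linear sM (nscl N) \<Lambda>" "\<And>c v. \<Lambda> (tN c v) = nscl N (\<mu> c) v"
    using AN.tensor_lift_exists by blast
  \<comment> \<open>Every later factor is \<open>a\<close> or \<open>b\<close> and contributes
    \<epsilon> = 1.\<close>
  have \<mu>_foldl: "\<mu> (foldl (mul A) c l) = \<mu> c" if "set l \<subseteq> {a, b}" for c l
    using that by (induction l rule: rev_induct) (auto simp: \<mu>(2) ab)
  \<comment> \<open>The list has \<open>a\<close> in slot \<open>r\<close>, zero-based
    \<open>r - 1\<close>, and \<open>b\<close> elsewhere; thus \<Lambda> recovers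
    \<open>f r bs\<close> from \<open>Psi\<close>.\<close>
  have eval: "\<Lambda> (Psi A sR tB sM tN n f (map2 tB ((replicate n b)[r - 1 := a]) bs)) = f r bs"
    if f: "f \<in> dend_cochains B N n" and r: "r \<in> {1..n}" and len: "length bs = n" for f r bs
  proof -
    let ?as = "(replicate n b)[r - 1 := a]"
    have "\<mu> (perm_product A s ?as) = (if s = r then 1 else 0)" if "s \<in> {1..n}" for s
    proof -
      have "set ?as \<subseteq> {a, b}"
        using set_update_subset_insert[of "replicate n b" "r - 1" a] by (auto split: if_splits)
      then have "set (rev (take (s - 1) ?as) @ drop s ?as) \<subseteq> {a, b}"
        using set_take_subset[of "s - 1" ?as] set_drop_subset[of s ?as] by auto
      then have "\<mu> (perm_product A s ?as) = \<mu> (?as ! (s - 1))"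
        unfolding perm_product_def by (rule \<mu>_foldl)
      moreover have "?as ! (s - 1) = (if s = r then a else b)"
        using that r by (auto simp: nth_list_update)
      ultimately show ?thesis
        by (simp add: ab)
    qed
    then have "(\<Sum>s=1..n. \<Lambda> (tN (perm_product A s ?as) (f s bs))) = (\<Sum>s=1..n. if s = r then f s bs else 0)"
      by (intro sum.cong) (auto simp: \<Lambda>(2))
    then show ?thesis
      using Psi_properties(2)[OF f] len r by (simp add: Psi_formula_def linear_sum_fun[OF \<Lambda>(1)])
  qed
  fix f h
  assume f: "f \<in> dend_cochains B N n" and h: "h \<in> dend_cochains B N n"
    and eq: "Psi A sR tB sM tN n f = Psi A sR tB sM tN n h"
  show "f = h"
  proof (intro ext)
    fix r bs
    show "f r bs = h r bs"
    proof (cases "r \<in> {1..n} \<and> length bs = n")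
      case True
      then show ?thesis
        using eval[OF f, of r bs] eval[OF h, of r bs] eq by simp
    next
      \<comment> \<open>Outside the valid indices and lengths both cochains are \<open>0\<close> by
        normalisation.\<close>
      case False
      then show ?thesis
        using dend_cochainsD(2,3)[OF f] dend_cochainsD(2,3)[OF h] by metis
    qed
  qed
qed

end

text \<open>Two distinct generators are what separates the summands. With a single generator
  \<open>A\<close> is commutative, all \<open>perm_product A r as\<close> coincide, and
  \<open>Psi\<close> sees only the sum of the components \<open>f r\<close>; with none,
  \<open>A\<close> is zero.\<close>

theorem mainTheorem2:
  fixes X :: "'x set"
    and A :: "('k::field, 'a::ab_group_add) alg"
    and B :: "('k, 'b::ab_group_add) dend"
    and N :: "('k, 'b, 'n::ab_group_add) dend_rep"
    and sR :: "'k \<Rightarrow> 'r::ab_group_add \<Rightarrow> 'r" and tB :: "'a \<Rightarrow> 'b \<Rightarrow> 'r"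
    and sM :: "'k \<Rightarrow> 'm::ab_group_add \<Rightarrow> 'm" and tN :: "'a \<Rightarrow> 'n \<Rightarrow> 'm"
  assumes "\<exists>x\<in>X. \<exists>y\<in>X. x \<noteq> y"
    and "free_perm_algebra X A"
    and "dendriform B"
    and "dend_representation B N"
    and "is_tensor_product (scl A) (dscl B) sR tB"
    and "is_tensor_product (scl A) (nscl N) sM tN"
  defines "R \<equiv> tensor_alg A B sR tB"
    and "M \<equiv> tensor_bimod A B N sR tB sM tN"
    and "\<Psi> \<equiv> Psi A sR tB sM tN"
  shows "\<forall>n\<ge>1.
      (\<forall>f \<in> dend_cochains B N n.
         \<Psi> n f \<in> hoch_cochains R M n \<and>
         Psi_formula A tB tN n f (\<Psi> n f) \<and>
         \<Psi> (n + 1) (dend_diff B N n f) = hoch_diff R M n (\<Psi> n f)) \<and>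
      (\<forall>f \<in> dend_cochains B N n. \<forall>g \<in> dend_cochains B N n.
         \<Psi> n (\<lambda>r bs. f r bs + g r bs) = (\<lambda>ts. \<Psi> n f ts + \<Psi> n g ts)) \<and>
      (\<forall>c. \<forall>f \<in> dend_cochains B N n.
         \<Psi> n (\<lambda>r bs. nscl N c (f r bs)) = (\<lambda>ts. sM c (\<Psi> n f ts))) \<and>
      inj_on (\<Psi> n) (dend_cochains B N n)"
proof -
  interpret tensor_cochains A B N sR tB sM tN
    by (intro tensor_cochains.intro tensor_product.intro tensor_cochains_axioms.intro
        perm_algebra_free_perm_algebra[OF assms(2)] assms(3-6))
  obtain x y where "x \<in> X" "y \<in> X" "x \<noteq> y"
    using assms(1) by blast
  then obtain \<mu> \<epsilon> a b where "Vector_Spaces.linear (scl A) (*) \<mu>"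
    "\<And>c d. \<mu> (mul A c d) = \<mu> c * \<epsilon> d" "\<mu> a = 1" "\<epsilon> a = 1" "\<mu> b = 0" "\<epsilon> b = 1"
    using free_perm_algebra_initial_functional[OF assms(2)] by metis
  then have "inj_on (Psi A sR tB sM tN n) (dend_cochains B N n)" for n
    by (rule Psi_inj_on)
  then show ?thesis
    unfolding R_def M_def \<Psi>_def hoch_cochains_def scl_R mscl_M
    using Psi_properties Psi_cochain_map Psi_add Psi_scale by blast
qed

end
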